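(* Let $S=\{z_1,\dots,z_m\}\subseteq\mathbb{Z}^n$ and let $Z=\sum_{i=1}^m[0,z_i]$ be the lattice zonotope generated by $S$. If $S$ is in linear general position, then $$\mu(Z)\le\frac{c\,n\log n}{m-n+1},$$ for some absolute constant $c>0$. Moreover, there is a set $S\subset\mathbb{Z}^n$ with $|S|=m$, in linear general position, such that the lattice zonotope $Z$ generated by $S$ satisfies $\mu(Z)\ge\frac{1}{m-n+1}$.
   Context: For $u,v\in\mathbb{R}^n$, $[u,v]$ denotes the line segment with endpoints $u$ and $v$, and the sum of segments is the Minkowski sum. A zonotope in $\mathbb{R}^n$ is a Minkowski sum of line segments $[a_i,b_i]$, $1\le i\le m$, where the vectors $b_i-a_i$ generate the whole space $\mathbb{R}^n$ (so $m\ge n$); the lattice zonotope generated by $S=\{z_1,\dots,z_m\}\subseteq\mathbb{Z}^n$ is $Z=\sum_{i=1}^m[0,z_i]$, where $z_1,\dots,z_m$ generate $\mathbb{R}^n$. A finite subset $S\subset\mathbb{R}^n$ is in linear general position (LGP) if any $n$ points in $S$ are linearly independent. For a convex body $K\subseteq\mathbb{R}^n$, the covering radius (with respect to the lattice $\mathbb{Z}^n$) is $\mu(K)=\inf\{\rho>0\mid \rho K+\mathbb{Z}^n=\mathbb{R}^n\}$.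
   Formalization: The dimension is assumed to satisfy n ≥ 2 in both parts: for n = 1 the upper bound is 0 since log 1 = 0, while μ(Z) > 0 (S = {1} gives μ = 1), and the lower bound fails for n = 1, m ≥ 3. *)

theory Defs
  imports "Jordan_Normal_Form.VS_Connect"
begin

text \<open>
  The dimension \<open>n\<close> has to be an ordinary variable, since the constant in the theorem is chosen
  before it.  Hence \<open>\<real>\<^sup>n\<close> is \<open>carrier_vec n :: real vec set\<close>.
\<close>

definition integer_lattice :: "nat \<Rightarrow> real vec set" where
  "integer_lattice n = {x \<in> carrier_vec n. \<forall>i<n. x $ i \<in> \<int>}"

abbreviation vec_lin_indpt :: "nat \<Rightarrow> real vec set \<Rightarrow> bool" where
  "vec_lin_indpt n T \<equiv> LinearCombinations.module.lin_indpt class_ring (module_vec TYPE(real) n) T"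

abbreviation vec_span :: "nat \<Rightarrow> real vec set \<Rightarrow> real vec set" where
  "vec_span n T \<equiv> LinearCombinations.module.span class_ring (module_vec TYPE(real) n) T"

definition linear_general_position :: "nat \<Rightarrow> real vec set \<Rightarrow> bool" where
  "linear_general_position n S \<longleftrightarrow>
     finite S \<and> S \<subseteq> carrier_vec n \<and> (\<forall>T\<subseteq>S. card T = n \<longrightarrow> vec_lin_indpt n T)"

definition segment :: "real vec \<Rightarrow> real vec \<Rightarrow> real vec set" where
  "segment u v = {(1 - t) \<cdot>\<^sub>v u + t \<cdot>\<^sub>v v | t. 0 \<le> t \<and> t \<le> 1}"

definition minkowski_sum :: "nat \<Rightarrow> ('i \<Rightarrow> real vec set) \<Rightarrow> 'i set \<Rightarrow> real vec set" where
  "minkowski_sum n A I = {finsum_vec TYPE(real) n f I | f. \<forall>i\<in>I. f i \<in> A i}"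

definition zonotope_generators :: "nat \<Rightarrow> real vec set \<Rightarrow> bool" where
  "zonotope_generators n S \<longleftrightarrow>
     finite S \<and> S \<subseteq> integer_lattice n \<and> vec_span n S = carrier_vec n"

definition lattice_zonotope :: "nat \<Rightarrow> real vec set \<Rightarrow> real vec set" where
  "lattice_zonotope n S = minkowski_sum n (\<lambda>z. segment (0\<^sub>v n) z) S"

text \<open>
  For a convex \<open>K\<close> with nonempty interior the set below is nonempty, so the real \<open>Inf\<close> is the
  mathematical infimum; if the set is empty, its value is arbitrary.
\<close>
definition covering_radius :: "nat \<Rightarrow> real vec set \<Rightarrow> real" where
  "covering_radius n K =
     Inf {\<rho>. \<rho> > 0 \<and> {\<rho> \<cdot>\<^sub>v x + w | x w. x \<in> K \<and> w \<in> integer_lattice n} = carrier_vec n}"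

end

theory Submission
  imports Defs "HOL-Analysis.Convex" "HOL-Computational_Algebra.Primes" "HOL-Computational_Algebra.Polynomial"
begin

text \<open>
  Write \<open>m = card S\<close> and \<open>D = m - n + 1\<close>.

  Behind the upper bound is the lattice width of the zonotope: an integer
  vector \<open>v \<noteq> 0\<close> is orthogonal to at most \<open>n - 1\<close> of the generators \<open>z\<^sub>i\<close>, so
  \<open>\<Sum>\<^sub>i |\<langle>v, z\<^sub>i\<rangle>| \<ge> D\<close>.  The passage from width to covering is probabilistic: a random vector
  \<open>X\<close> that mostly lies in a small dilate of the (centred) zonotope and is almost equidistributed
  modulo the lattice shows that this dilate covers more than half of the torus, and then twice the
  dilate covers everything, because two subsets of a finite group, each larger than half of it,
  have sum set the whole group.  To stay with finite sums, the torus is replaced by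
  \<open>(\<int>/p)\<^sup>n\<close> for a large prime \<open>p\<close>, and \<open>X\<close> by a sum of independent random bits times
  generators, \<open>L\<^sub>i\<close> bits for the generator \<open>z\<^sub>i\<close>, with \<open>L\<^sub>i\<close> of order \<open>\<sigma>\<^sup>2 s\<^sub>i\<close> for a scale \<open>\<sigma>\<close> and
  weights \<open>s\<^sub>i > 0\<close>.

  The weights have to serve two purposes.  First, \<open>X\<close> must have small coefficients.  The obvious
  representation of \<open>X\<close> by the generators is wasteful; the one that minimizes
  \<open>\<Sum>\<^sub>i t\<^sub>i\<^sup>2 / s\<^sub>i\<close> is linear in the bits and its \<open>i\<close>-th coefficient has variance at most a constant
  times \<open>\<sigma>\<^sup>2 s\<^sub>i\<^sup>2 G\<^sub>i\<^sub>i\<close>, where \<open>G\<^sub>i\<^sub>i = \<langle>z\<^sub>i, M z\<^sub>i\<rangle>\<close> and \<open>M\<close> is the inverse of \<open>\<Sum>\<^sub>i s\<^sub>i z\<^sub>i z\<^sub>i\<^sup>T\<close>.  Second,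
  \<open>\<Sum>\<^sub>i s\<^sub>i \<langle>v, z\<^sub>i\<rangle>\<^sup>2\<close> must be large compared with \<open>(\<Sum>\<^sub>i |\<langle>v, z\<^sub>i\<rangle>|)\<^sup>2\<close>, which by Cauchy-Schwarz
  asks for \<open>\<Sum>\<^sub>i 1 / s\<^sub>i\<close> to be small.  Lewis weights, \<open>s\<^sub>i\<^sup>2 G\<^sub>i\<^sub>i = 1\<close>, do both, since
  \<open>\<Sum>\<^sub>i s\<^sub>i G\<^sub>i\<^sub>i = n\<close> always; approximate ones suffice (\<open>Lewis_weights_exist\<close>).

  With these weights all coefficients have standard deviation of order \<open>\<sigma>\<close>, and the exceedances
  over \<open>\<sigma> ln n\<close> have total weighted square of order \<open>\<sigma>\<^sup>2\<close> on average.  Representing the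
  exceedances once more in the minimizing way makes every coefficient of that part \<open>O(\<sigma>)\<close>.  Thus
  no factor \<open>ln m\<close> appears (\<open>centred_count_has_small_coefficients\<close>).

  By Fourier inversion, equidistribution follows if the sum over all residue vectors \<open>v\<close> of
  \<open>\<Prod>\<^sub>i |cos (\<pi> \<langle>v, z\<^sub>i\<rangle> / p)|\<^bsup>L\<^sub>i\<^esup>\<close> is close to its term \<open>1\<close> for \<open>v = 0\<close>.  Splitting the
  generators into about \<open>m / n\<close> bases and using convexity of the exponential reduces the sum to
  one for a single basis, which is a product of geometric series (\<open>theta_sum_le\<close>).  It suffices
  that \<open>\<sigma>\<close> is of order \<open>p n / D\<close>, and after division by \<open>p\<close> the dilation factor is
  \<open>O(n ln n / D)\<close>.

  For the lower bound, if \<open>n - 1\<close> generators have first coordinate \<open>0\<close> and the other \<open>D\<close> have first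
  coordinate \<open>1\<close>, then \<open>\<rho> Z\<close> has width \<open>\<rho> D\<close> in the first coordinate, so \<open>\<rho> D \<ge> 1\<close> is
  necessary for covering.  The points with first coordinate \<open>1\<close> are taken one after the other on
  the moment curve, each off finitely many hyperplanes such that every set of fewer than \<open>n\<close>
  earlier points lies in one of them.
\<close>

section \<open>Dual frames of weighted vector systems\<close>

definition dot :: "nat \<Rightarrow> (nat \<Rightarrow> real) \<Rightarrow> (nat \<Rightarrow> real) \<Rightarrow> real" where
  "dot n u v = (\<Sum>a<n. u a * v a)"

lemma dot_commute: "dot n u v = dot n v u"
  unfolding dot_def by (simp add: mult.commute)

lemma dot_sum_right: "dot n u (\<lambda>a. \<Sum>i\<in>I. c i * z i a) = (\<Sum>i\<in>I. c i * dot n u (z i))"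
  unfolding dot_def sum_distrib_left by (subst sum.swap) (simp add: mult_ac)

lemma dot_cong: "(\<And>a. a < n \<Longrightarrow> u a = u' a) \<Longrightarrow> (\<And>a. a < n \<Longrightarrow> v a = v' a) \<Longrightarrow> dot n u v = dot n u' v'"
  unfolding dot_def by (intro sum.cong) auto

text \<open>
  Matrix inversion in terms of coordinate functions, so that the analytic part can work with
  plain finite sums.
\<close>
lemma two_sided_inverse:
  fixes A :: "nat \<Rightarrow> nat \<Rightarrow> real"
  assumes inj: "\<And>v. (\<And>a. a < n \<Longrightarrow> (\<Sum>b<n. A a b * v b) = 0) \<Longrightarrow> (\<And>b. b < n \<Longrightarrow> v b = 0)"
  obtains M where
    "\<And>a c. a < n \<Longrightarrow> c < n \<Longrightarrow> (\<Sum>b<n. A a b * M b c) = (if a = c then 1 else 0)"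
    "\<And>a c. a < n \<Longrightarrow> c < n \<Longrightarrow> (\<Sum>b<n. M a b * A b c) = (if a = c then 1 else 0)"
proof -
  define AA where "AA = mat n n (\<lambda>(a, b). A a b)"
  have AA: "AA \<in> carrier_mat n n" unfolding AA_def by simp
  have det: "det AA \<noteq> 0"
  proof
    assume "det AA = 0"
    then obtain v where v: "v \<in> carrier_vec n" "v \<noteq> 0\<^sub>v n" "AA *\<^sub>v v = 0\<^sub>v n"
      using det_0_iff_vec_prod_zero_field[OF AA] by blast
    have "(\<Sum>b<n. A a b * v $ b) = 0" if "a < n" for a
    proof -
      have "(AA *\<^sub>v v) $ a = (\<Sum>b<n. A a b * v $ b)"
        using that v(1) unfolding AA_def by (simp add: scalar_prod_def lessThan_atLeast0)
      with v(3) that show ?thesis by simp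
    qed
    then have "v $ b = 0" if "b < n" for b using inj[of "($) v"] that by blast
    then have "v = 0\<^sub>v n" using v(1) by (intro eq_vecI) auto
    with v(2) show False by simp
  qed
  from det_non_zero_imp_unit[OF AA det, of "()"] obtain B where
    B: "B * AA = 1\<^sub>m n" "AA * B = 1\<^sub>m n" "B \<in> carrier_mat n n"
    unfolding Units_def ring_mat_def by auto
  show thesis
  proof (rule that[of "\<lambda>a b. B $$ (a, b)"])
    fix a c assume ac: "a < n" "c < n"
    have "(AA * B) $$ (a, c) = (\<Sum>b<n. A a b * B $$ (b, c))"
      using ac B(3) unfolding AA_def by (simp add: scalar_prod_def lessThan_atLeast0)
    then show "(\<Sum>b<n. A a b * B $$ (b, c)) = (if a = c then 1 else 0)"
      using B(2) ac by simp
    have "(B * AA) $$ (a, c) = (\<Sum>b<n. B $$ (a, b) * A b c)"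
      using ac B(3) unfolding AA_def by (simp add: scalar_prod_def lessThan_atLeast0)
    then show "(\<Sum>b<n. B $$ (a, b) * A b c) = (if a = c then 1 else 0)"
      using B(1) ac by simp
  qed
qed

text \<open>
  The vectors \<open>y\<^sub>j = M z\<^sub>j\<close> where \<open>M\<close> is the inverse of the frame operator \<open>\<Sum>\<^sub>i s\<^sub>i z\<^sub>i z\<^sub>i\<^sup>T\<close>.  The
  three conditions are what is needed of them: symmetry of the Gram matrix \<open>\<langle>z\<^sub>i, M z\<^sub>j\<rangle>\<close>, the
  reconstruction formula, and the trace of \<open>M\<close> times the frame operator.
\<close>
definition dual_frame :: "nat \<Rightarrow> 'i set \<Rightarrow> ('i \<Rightarrow> nat \<Rightarrow> real) \<Rightarrow> ('i \<Rightarrow> real) \<Rightarrow> ('i \<Rightarrow> nat \<Rightarrow> real) \<Rightarrow> bool" where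
  "dual_frame n I z s y \<longleftrightarrow>
     (\<forall>i\<in>I. \<forall>j\<in>I. dot n (z i) (y j) = dot n (z j) (y i)) \<and>
     (\<forall>x. \<forall>a<n. (\<Sum>i\<in>I. s i * dot n x (y i) * z i a) = x a) \<and>
     (\<Sum>i\<in>I. s i * dot n (z i) (y i)) = real n"

lemma dual_frame_exists:
  fixes z :: "'i \<Rightarrow> nat \<Rightarrow> real"
  assumes fin: "finite I" and pos: "\<And>i. i \<in> I \<Longrightarrow> s i > 0"
    and span: "\<And>v. (\<And>i. i \<in> I \<Longrightarrow> dot n v (z i) = 0) \<Longrightarrow> (\<And>a. a < n \<Longrightarrow> v a = 0)"
  shows "\<exists>y. dual_frame n I z s y"
proof -
  define A where "A a b = (\<Sum>i\<in>I. s i * z i a * z i b)" for a b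
  have Asym: "A a b = A b a" for a b unfolding A_def by (simp add: mult_ac)
  have inj: "v b = 0" if h: "\<And>a. a < n \<Longrightarrow> (\<Sum>b<n. A a b * v b) = 0" and b: "b < n" for v b
  proof -
    have "(\<Sum>i\<in>I. s i * (dot n v (z i))^2) = (\<Sum>i\<in>I. \<Sum>a<n. \<Sum>b<n. v a * (s i * z i a * z i b * v b))"
      unfolding dot_def power2_eq_square sum_product sum_distrib_left
      by (intro sum.cong refl) (simp add: mult_ac sum_distrib_left)
    also have "\<dots> = (\<Sum>a<n. \<Sum>i\<in>I. \<Sum>b<n. v a * (s i * z i a * z i b * v b))"
      by (rule sum.swap)
    also have "\<dots> = (\<Sum>a<n. \<Sum>b<n. \<Sum>i\<in>I. v a * (s i * z i a * z i b * v b))"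
      by (intro sum.cong refl sum.swap)
    also have "\<dots> = (\<Sum>a<n. v a * (\<Sum>b<n. A a b * v b))"
      unfolding A_def sum_distrib_left sum_distrib_right by simp
    also have "\<dots> = 0" using h by simp
    finally have "\<forall>i\<in>I. s i * (dot n v (z i))^2 = 0"
      using pos fin by (subst (asm) sum_nonneg_eq_0_iff) (auto intro!: mult_nonneg_nonneg intro: less_imp_le)
    then have "dot n v (z i) = 0" if "i \<in> I" for i using pos[OF that] that by fastforce
    then show ?thesis using span b by blast
  qed
  obtain M where AM: "\<And>a c. a < n \<Longrightarrow> c < n \<Longrightarrow> (\<Sum>b<n. A a b * M b c) = (if a = c then 1 else 0)"
    and MA: "\<And>a c. a < n \<Longrightarrow> c < n \<Longrightarrow> (\<Sum>b<n. M a b * A b c) = (if a = c then 1 else 0)"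
    using two_sided_inverse[of n A] inj by blast
  have Msym: "M a c = M c a" if ac: "a < n" "c < n" for a c
  proof -
    have "M a c = (\<Sum>b<n. M a b * (if b = c then 1 else 0))"
      using ac by (simp add: if_distrib cong: if_cong)
    also have "\<dots> = (\<Sum>b<n. M a b * (\<Sum>e<n. M c e * A e b))"
      using MA ac by (intro sum.cong refl) auto
    also have "\<dots> = (\<Sum>e<n. M c e * (\<Sum>b<n. A e b * M a b))"
      unfolding sum_distrib_left by (subst sum.swap) (simp add: mult_ac)
    also have "\<dots> = (\<Sum>e<n. M c e * (\<Sum>b<n. M a b * A b e))"
      using Asym by (simp add: mult_ac)
    also have "\<dots> = (\<Sum>e<n. M c e * (if a = e then 1 else 0))"
      using MA ac by (intro sum.cong refl) auto
    also have "\<dots> = M c a" using ac by (simp add: if_distrib cong: if_cong)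
    finally show ?thesis .
  qed
  define y where "y j a = (\<Sum>b<n. M a b * z j b)" for j a
  have dy: "dot n x (y j) = (\<Sum>a<n. \<Sum>b<n. M a b * x a * z j b)" for x j
    unfolding y_def dot_def sum_distrib_left by (simp add: mult_ac)
  have "dot n (z i) (y j) = dot n (z j) (y i)" for i j
  proof -
    have "dot n (z i) (y j) = (\<Sum>a<n. \<Sum>b<n. M b a * z i a * z j b)"
      unfolding dy using Msym by (intro sum.cong refl) auto
    also have "\<dots> = (\<Sum>b<n. \<Sum>a<n. M b a * z i a * z j b)" by (rule sum.swap)
    finally show ?thesis unfolding dy by (simp add: mult_ac)
  qed
  moreover have "(\<Sum>i\<in>I. s i * dot n x (y i) * z i c) = x c" if c: "c < n" for x c
  proof -
    have "(\<Sum>i\<in>I. s i * dot n x (y i) * z i c) = (\<Sum>i\<in>I. \<Sum>a<n. \<Sum>b<n. x a * M a b * (s i * z i b * z i c))"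
      unfolding dy sum_distrib_left sum_distrib_right by (simp add: mult_ac)
    also have "\<dots> = (\<Sum>a<n. \<Sum>i\<in>I. \<Sum>b<n. x a * M a b * (s i * z i b * z i c))"
      by (rule sum.swap)
    also have "\<dots> = (\<Sum>a<n. \<Sum>b<n. \<Sum>i\<in>I. x a * M a b * (s i * z i b * z i c))"
      by (intro sum.cong refl sum.swap)
    also have "\<dots> = (\<Sum>a<n. x a * (\<Sum>b<n. M a b * A b c))"
      unfolding A_def sum_distrib_left by (simp add: mult_ac)
    also have "\<dots> = (\<Sum>a<n. x a * (if a = c then 1 else 0))"
      using MA c by (intro sum.cong refl) auto
    also have "\<dots> = x c" using c by (simp add: if_distrib cong: if_cong)
    finally show ?thesis .
  qed
  moreover have "(\<Sum>i\<in>I. s i * dot n (z i) (y i)) = real n"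
  proof -
    have "(\<Sum>i\<in>I. s i * dot n (z i) (y i)) = (\<Sum>i\<in>I. \<Sum>a<n. \<Sum>b<n. M a b * (s i * z i b * z i a))"
      unfolding dy sum_distrib_left by (simp add: mult_ac)
    also have "\<dots> = (\<Sum>a<n. \<Sum>i\<in>I. \<Sum>b<n. M a b * (s i * z i b * z i a))"
      by (rule sum.swap)
    also have "\<dots> = (\<Sum>a<n. \<Sum>b<n. \<Sum>i\<in>I. M a b * (s i * z i b * z i a))"
      by (intro sum.cong refl sum.swap)
    also have "\<dots> = (\<Sum>a<n. (\<Sum>b<n. M a b * A b a))"
      unfolding A_def sum_distrib_left by (simp add: mult_ac)
    also have "\<dots> = real n" using MA by simp
    finally show ?thesis .
  qed
  ultimately show ?thesis unfolding dual_frame_def by blast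
qed

lemma dual_frame_reproduces:
  assumes "dual_frame n I z s y" "a < n"
  shows "(\<Sum>i\<in>I. s i * dot n x (y i) * z i a) = x a"
  using assms unfolding dual_frame_def by blast

lemma dual_frame_sum_squares:
  assumes "dual_frame n I z s y" and j: "j \<in> I"
  shows "(\<Sum>i\<in>I. s i * (dot n (z i) (y j))^2) = dot n (z j) (y j)"
proof -
  have "dot n (y j) (z j) = dot n (y j) (\<lambda>a. \<Sum>i\<in>I. (s i * dot n (z j) (y i)) * z i a)"
    by (rule dot_cong) (simp_all only: dual_frame_reproduces[OF assms(1)])
  also have "\<dots> = (\<Sum>i\<in>I. s i * dot n (z j) (y i) * dot n (y j) (z i))"
    by (rule dot_sum_right)
  also have "\<dots> = (\<Sum>i\<in>I. s i * (dot n (z i) (y j))^2)"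
    using assms unfolding dual_frame_def
    by (intro sum.cong refl) (auto simp: power2_eq_square dot_commute[of n "y j"])
  finally show ?thesis by (simp add: dot_commute)
qed

lemma weighted_Cauchy_Schwarz:
  fixes f g s :: "'i \<Rightarrow> real"
  assumes "\<And>i. i \<in> I \<Longrightarrow> s i > 0"
  shows "(\<Sum>i\<in>I. f i * g i)^2 \<le> (\<Sum>i\<in>I. s i * (f i)^2) * (\<Sum>i\<in>I. (g i)^2 / s i)"
proof -
  have "(\<Sum>i\<in>I. f i * g i) = (\<Sum>i\<in>I. (sqrt (s i) * f i) * (g i / sqrt (s i)))"
    using assms by (intro sum.cong refl) (auto simp: field_simps dest!: assms)
  also have "(\<dots>)^2 \<le> (\<Sum>i\<in>I. (sqrt (s i) * f i)^2) * (\<Sum>i\<in>I. (g i / sqrt (s i))^2)"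
    by (rule Cauchy_Schwarz_ineq_sum)
  also have "\<dots> = (\<Sum>i\<in>I. s i * (f i)^2) * (\<Sum>i\<in>I. (g i)^2 / s i)"
    using assms by (intro arg_cong2[of _ _ _ _ "(*)"] sum.cong refl)
      (auto simp: power_mult_distrib power_divide less_imp_le)
  finally show ?thesis .
qed

text \<open>
  The diagonal entry \<open>\<langle>z\<^sub>j, y\<^sub>j\<rangle>\<close> is the squared norm of the functional \<open>v \<mapsto> \<langle>v, z\<^sub>j\<rangle>\<close> with respect to
  the form \<open>\<Sum>\<^sub>i s\<^sub>i \<langle>v, z\<^sub>i\<rangle>\<^sup>2\<close>: expand \<open>z\<^sub>j\<close> by the reconstruction formula and apply Cauchy-Schwarz.
  This variational description gives the monotonicity in the weights below.
\<close>
lemma dual_frame_extremal: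
  assumes df: "dual_frame n I z s y" and pos: "\<And>i. i \<in> I \<Longrightarrow> s i > 0" and j: "j \<in> I"
  shows "(dot n v (z j))^2 \<le> dot n (z j) (y j) * (\<Sum>i\<in>I. s i * (dot n v (z i))^2)"
proof -
  have "dot n v (z j) = dot n v (\<lambda>a. \<Sum>i\<in>I. (s i * dot n (z j) (y i)) * z i a)"
    by (rule dot_cong) (simp_all only: dual_frame_reproduces[OF df])
  also have "\<dots> = (\<Sum>i\<in>I. s i * dot n (z j) (y i) * dot n v (z i))"
    by (rule dot_sum_right)
  also have "\<dots> = (\<Sum>i\<in>I. dot n (z i) (y j) * (s i * dot n v (z i)))"
    using df j unfolding dual_frame_def by (intro sum.cong refl) auto
  also have "(\<dots>)^2 \<le> (\<Sum>i\<in>I. s i * (dot n (z i) (y j))^2) * (\<Sum>i\<in>I. (s i * dot n v (z i))^2 / s i)"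
    using pos by (rule weighted_Cauchy_Schwarz)
  also have "(\<Sum>i\<in>I. (s i * dot n v (z i))^2 / s i) = (\<Sum>i\<in>I. s i * (dot n v (z i))^2)"
    by (intro sum.cong refl) (auto simp: power2_eq_square)
  finally show ?thesis using dual_frame_sum_squares[OF df j] by simp
qed

lemma dual_frame_pos:
  assumes fin: "finite I" and df: "dual_frame n I z s y" and pos: "\<And>i. i \<in> I \<Longrightarrow> s i > 0" and j: "j \<in> I"
    and nz: "\<exists>a<n. z j a \<noteq> 0"
  shows "dot n (z j) (y j) > 0"
proof -
  have ge: "dot n (z j) (y j) \<ge> 0"
    unfolding dual_frame_sum_squares[OF df j, symmetric]
    using pos by (intro sum_nonneg mult_nonneg_nonneg) (auto intro: less_imp_le)
  have "dot n (z j) (y j) \<noteq> 0"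
  proof
    assume "dot n (z j) (y j) = 0"
    then have "(dot n (z j) (z j))^2 \<le> 0"
      using dual_frame_extremal[OF df pos j, of "z j"] by simp
    then have "dot n (z j) (z j) = 0" by simp
    then have "(\<Sum>a<n. (z j a)^2) = 0" unfolding dot_def by (simp add: power2_eq_square)
    then have "\<forall>a<n. z j a = 0" by (subst (asm) sum_nonneg_eq_0_iff) auto
    with nz show False by blast
  qed
  with ge show ?thesis by simp
qed

text \<open>
  Larger weights make the quadratic form larger and hence the dual norm of \<open>z\<^sub>j\<close> smaller.  The
  proof tests the extremal inequality for \<open>s'\<close> with \<open>v = y\<^sub>j\<close>, for which the one for \<open>s\<close> is an
  equality.
\<close>
lemma dual_frame_monotone:
  assumes fin: "finite I"
    and df: "dual_frame n I z s y" and df': "dual_frame n I z s' y'"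
    and pos: "\<And>i. i \<in> I \<Longrightarrow> s i > 0" and pos': "\<And>i. i \<in> I \<Longrightarrow> s' i > 0"
    and le: "\<And>i. i \<in> I \<Longrightarrow> s' i \<le> \<alpha> * s i" and j: "j \<in> I"
    and nz: "\<exists>a<n. z j a \<noteq> 0"
  shows "dot n (z j) (y j) \<le> \<alpha> * dot n (z j) (y' j)"
proof -
  let ?g = "dot n (z j) (y j)"
  have g: "?g > 0" using dual_frame_pos[OF fin df pos j nz] .
  have g': "dot n (z j) (y' j) > 0" using dual_frame_pos[OF fin df' pos' j nz] .
  have "?g^2 \<le> dot n (z j) (y' j) * (\<Sum>i\<in>I. s' i * (dot n (y j) (z i))^2)"
    using dual_frame_extremal[OF df' pos' j, of "y j"] by (simp add: dot_commute)
  also have "\<dots> \<le> dot n (z j) (y' j) * (\<Sum>i\<in>I. \<alpha> * s i * (dot n (y j) (z i))^2)"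
    using g' le by (intro mult_left_mono sum_mono mult_right_mono) auto
  also have "\<dots> = dot n (z j) (y' j) * (\<alpha> * ?g)"
    using dual_frame_sum_squares[OF df j]
    by (simp add: dot_commute[of n "y j"] sum_distrib_left[symmetric] mult.assoc)
  finally have "?g * ?g \<le> (\<alpha> * dot n (z j) (y' j)) * ?g" by (simp add: power2_eq_square mult_ac)
  then show ?thesis using g by simp
qed


section \<open>Lewis weights\<close>

text \<open>
  Exact Lewis weights are the fixed points of \<open>s\<^sub>i \<mapsto> 1 / \<surd>\<langle>z\<^sub>i, y\<^sub>i\<rangle>\<close>.  By \<open>dual_frame_monotone\<close>, if
  two weight vectors agree up to a factor \<open>\<alpha>\<close>, their images agree up to \<open>\<surd>\<alpha>\<close>: the map halves
  logarithmic distances.  So iterating from any start makes consecutive iterates agree up to a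
  factor \<open>2\<close> after finitely many steps, and such an iterate is good enough; no limit is taken.
\<close>
lemma Lewis_weights_exist:
  fixes z :: "'i \<Rightarrow> nat \<Rightarrow> real"
  assumes fin: "finite I"
    and span: "\<And>v a. (\<And>i. i \<in> I \<Longrightarrow> dot n v (z i) = 0) \<Longrightarrow> a < n \<Longrightarrow> v a = 0"
    and nz: "\<And>i. i \<in> I \<Longrightarrow> \<exists>a<n. z i a \<noteq> 0"
  shows "\<exists>s y. dual_frame n I z s y \<and> (\<forall>i\<in>I. s i > 0) \<and>
           (\<forall>i\<in>I. (s i)^2 * dot n (z i) (y i) \<le> 4) \<and> (\<Sum>i\<in>I. 1 / s i) \<le> 4 * real n"
proof (cases "I = {}")
  case True
  then show ?thesis
    using dual_frame_exists[OF fin, of "\<lambda>_. 1" n z] span by auto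
next
  case False
  define Y where "Y s = (SOME y. dual_frame n I z s y)" for s :: "'i \<Rightarrow> real"
  have Y: "dual_frame n I z s (Y s)" if "\<And>i. i \<in> I \<Longrightarrow> s i > 0" for s
  proof -
    have "\<exists>y. dual_frame n I z s y"
      by (rule dual_frame_exists[OF fin]) (use that in blast, rule span)
    then show ?thesis unfolding Y_def by (rule someI_ex)
  qed
  define q where "q s i = dot n (z i) (Y s i)" for s i
  define F where "F s i = 1 / sqrt (q s i)" for s i
  have q_pos: "q s i > 0" if "\<And>i. i \<in> I \<Longrightarrow> s i > 0" "i \<in> I" for s i
    unfolding q_def by (rule dual_frame_pos[OF fin Y]) (use that nz in auto)
  define S where "S k = (F ^^ k) (\<lambda>_. 1)" for k
  have S_Suc: "S (Suc k) = F (S k)" for k unfolding S_def by simp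
  have S_pos: "S k i > 0" if "i \<in> I" for k i
    using that
  proof (induction k arbitrary: i)
    case 0 then show ?case by (simp add: S_def)
  next
    case (Suc k)
    then show ?case unfolding S_Suc F_def using q_pos[of "S k" i] by simp
  qed
  have step: "F s' i \<le> sqrt \<alpha> * F s i"
    if "\<And>i. i \<in> I \<Longrightarrow> s i > 0" "\<And>i. i \<in> I \<Longrightarrow> s' i > 0" "\<And>i. i \<in> I \<Longrightarrow> s' i \<le> \<alpha> * s i" "i \<in> I" for s s' \<alpha> i
  proof -
    have le: "q s i \<le> \<alpha> * q s' i"
      unfolding q_def
      by (rule dual_frame_monotone[OF fin Y Y]) (use that nz in auto)
    have "0 < q s i" "0 < q s' i" using q_pos that by blast+
    moreover have "sqrt (q s i) \<le> sqrt \<alpha> * sqrt (q s' i)"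
      using real_sqrt_le_mono[OF le] by (simp add: real_sqrt_mult)
    ultimately show ?thesis unfolding F_def by (simp add: field_simps)
  qed
  \<comment> \<open>The factor between the first two iterates; the factor after \<open>k\<close> steps is its \<open>2\<^sup>k\<close>-th root.\<close>
  define R where "R = Max ((\<lambda>i. max (S 1 i) (1 / S 1 i)) ` I)"
  have R: "S 1 i \<le> R" "1 / S 1 i \<le> R" if "i \<in> I" for i
  proof -
    have "max (S 1 i) (1 / S 1 i) \<le> R" unfolding R_def using fin that by (intro Max_ge) auto
    then show "S 1 i \<le> R" "1 / S 1 i \<le> R" by auto
  qed
  have Rpos: "R > 0" using R(1) S_pos False by (meson all_not_in_conv less_le_trans)
  define C where "C = (\<lambda>k::nat. (sqrt ^^ k) R)"
  have contract: "S (Suc k) i \<le> C k * S k i \<and> S k i \<le> C k * S (Suc k) i" if "i \<in> I" for k i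
    using that
  proof (induction k arbitrary: i)
    case 0
    then show ?case using R[of i] S_pos[of i 1] by (simp add: C_def S_def field_simps)
  next
    case (Suc k)
    have "F (S (Suc k)) i \<le> sqrt (C k) * F (S k) i"
      by (rule step) (use Suc S_pos in auto)
    moreover have "F (S k) i \<le> sqrt (C k) * F (S (Suc k)) i"
      by (rule step) (use Suc S_pos in auto)
    ultimately show ?case by (simp add: S_Suc C_def)
  qed
  have C_eq: "C k = R powr ((1/2) ^ k)" for k
  proof (induction k)
    case 0 then show ?case using Rpos by (simp add: C_def)
  next
    case (Suc k)
    have "C (Suc k) = sqrt (C k)" by (simp add: C_def)
    also have "\<dots> = (R powr ((1/2) ^ k)) powr (1/2)" unfolding Suc by (simp add: powr_half_sqrt)
    also have "\<dots> = R powr ((1/2) ^ Suc k)" by (simp add: powr_powr mult.commute)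
    finally show ?case .
  qed
  have "(\<lambda>k. R powr ((1/2) ^ k)) \<longlonglongrightarrow> R powr 0"
    using Rpos by (intro tendsto_intros LIMSEQ_realpow_zero) auto
  then have "eventually (\<lambda>k. R powr ((1/2) ^ k) < 2) sequentially"
    using Rpos by (intro order_tendstoD(2)) auto
  then obtain k where k: "C k < 2" unfolding C_eq by (auto simp: eventually_sequentially)
  have pos: "S k i > 0" if "i \<in> I" for i using S_pos[OF that] .
  have near: "F (S k) i \<le> 2 * S k i" "S k i \<le> 2 * F (S k) i" if "i \<in> I" for i
  proof -
    have c: "F (S k) i \<le> C k * S k i" "S k i \<le> C k * F (S k) i"
      using contract[OF that, of k] by (simp_all add: S_Suc)
    have "C k * S k i \<le> 2 * S k i" "C k * F (S k) i \<le> 2 * F (S k) i"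
      using k S_pos[OF that, of k] S_pos[OF that, of "Suc k"]
      by (intro mult_right_mono; simp add: S_Suc less_imp_le)+
    with c show "F (S k) i \<le> 2 * S k i" "S k i \<le> 2 * F (S k) i" by linarith+
  qed
  have sq: "(F (S k) i)^2 * q (S k) i = 1" if "i \<in> I" for i
    using q_pos[of "S k" i] pos that by (simp add: F_def power_divide)
  have "(S k i)^2 * q (S k) i \<le> 4" if "i \<in> I" for i
  proof -
    have "(S k i)^2 \<le> (2 * F (S k) i)^2"
      using near(2)[OF that] pos[OF that] by (intro power_mono) auto
    then have "(S k i)^2 * q (S k) i \<le> (2 * F (S k) i)^2 * q (S k) i"
      using q_pos[of "S k" i] pos that by (intro mult_right_mono) auto
    also have "\<dots> = 4" using sq[OF that] by (simp add: power_mult_distrib)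
    finally show ?thesis .
  qed
  moreover have "(\<Sum>i\<in>I. 1 / S k i) \<le> 4 * real n"
  proof -
    have "1 / S k i \<le> 4 * (S k i * q (S k) i)" if "i \<in> I" for i
    proof -
      have "(F (S k) i)^2 \<le> (2 * S k i)^2"
        using near(1)[OF that] q_pos[of "S k" i] pos that by (intro power_mono) (auto simp: F_def less_imp_le)
      then have "(F (S k) i)^2 * q (S k) i \<le> (2 * S k i)^2 * q (S k) i"
        using q_pos[of "S k" i] pos that by (intro mult_right_mono) auto
      then have "1 \<le> 4 * (S k i * q (S k) i) * S k i"
        using sq[OF that] by (simp add: power2_eq_square mult_ac)
      then show ?thesis using pos[OF that] by (simp add: field_simps)
    qed
    then have "(\<Sum>i\<in>I. 1 / S k i) \<le> (\<Sum>i\<in>I. 4 * (S k i * q (S k) i))" by (rule sum_mono)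
    also have "\<dots> = 4 * real n"
      using Y[of "S k"] pos by (simp add: sum_distrib_left[symmetric] dual_frame_def q_def)
    finally show ?thesis .
  qed
  ultimately show ?thesis using Y[of "S k"] pos unfolding q_def by blast
qed

section \<open>Exponential sums over the cube and over residue classes\<close>

text \<open>
  Integer-valued so that sums of bits times lattice vectors are lattice vectors; probabilities are
  ratios of cardinalities of subsets of the cube.
\<close>
definition cube :: "'l set \<Rightarrow> ('l \<Rightarrow> int) set" where
  "cube L = PiE L (\<lambda>_. {0, 1})"

lemma finite_cube: "finite L \<Longrightarrow> finite (cube L)"
  unfolding cube_def by (intro finite_PiE) auto

lemma card_cube: "finite L \<Longrightarrow> card (cube L) = 2 ^ card L"
  unfolding cube_def by (simp add: card_PiE numeral_2_eq_2)

lemma sum_cube_prod: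
  fixes f :: "'l \<Rightarrow> int \<Rightarrow> 'a::comm_semiring_1"
  assumes "finite L"
  shows "(\<Sum>\<omega>\<in>cube L. \<Prod>l\<in>L. f l (\<omega> l)) = (\<Prod>l\<in>L. f l 0 + f l 1)"
  unfolding cube_def using assms by (subst prod_sum_PiE[symmetric]) auto

lemma tanh_le_self: "x \<ge> 0 \<Longrightarrow> tanh x \<le> (x::real)"
proof -
  assume x: "x \<ge> 0"
  have "(\<lambda>x. x - tanh x) 0 \<le> (\<lambda>x. x - tanh x) x"
  proof (rule DERIV_nonneg_imp_nondecreasing[OF x])
    fix t :: real
    have "cosh t \<noteq> 0" using cosh_real_pos[of t] by linarith
    then have "((\<lambda>x. x - tanh x) has_real_derivative (1 - (1 - (tanh t)^2) * 1)) (at t)"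
      by (intro derivative_intros) auto
    then show "\<exists>y. ((\<lambda>x. x - tanh x) has_real_derivative y) (at t) \<and> 0 \<le> y"
      by (intro exI[of _ "(tanh t)^2"]) auto
  qed
  then show ?thesis by simp
qed

lemma cosh_le_exp_half_square: "cosh x \<le> exp (x^2 / 2)" for x :: real
proof -
  have main: "cosh x \<le> exp (x^2 / 2)" if x: "x \<ge> 0" for x :: real
  proof -
    have "(\<lambda>x. x^2 / 2 - ln (cosh x)) 0 \<le> (\<lambda>x. x^2 / 2 - ln (cosh x)) x"
    proof (rule DERIV_nonneg_imp_nondecreasing[OF x])
      fix t :: real assume t: "0 \<le> t"
      have "((\<lambda>x. x^2 / 2 - ln (cosh x)) has_real_derivative (t - tanh t)) (at t)"
        by (auto intro!: derivative_eq_intros simp: cosh_real_pos tanh_def field_simps)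
      then show "\<exists>y. ((\<lambda>x. x^2 / 2 - ln (cosh x)) has_real_derivative y) (at t) \<and> 0 \<le> y"
        using tanh_le_self[OF t] by (intro exI[of _ "t - tanh t"]) auto
    qed
    then have "ln (cosh x) \<le> x^2 / 2" by simp
    then show ?thesis by (metis cosh_real_pos exp_le_cancel_iff exp_ln)
  qed
  show ?thesis using main[of x] main[of "-x"] by (cases "x \<ge> 0") auto
qed

text \<open>
  The sub-Gaussian bound for sums of independent centred bits, from
  \<open>cosh x \<le> exp (x\<^sup>2 / 2)\<close> for each factor.
\<close>
lemma sum_cube_exp_le:
  fixes \<beta> :: "'l \<Rightarrow> real"
  assumes "finite L"
  shows "(\<Sum>\<omega>\<in>cube L. exp (\<Sum>l\<in>L. (of_int (\<omega> l) - 1 / 2) * \<beta> l)) \<le> 2 ^ card L * exp ((\<Sum>l\<in>L. (\<beta> l)^2) / 8)"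
proof -
  have "(\<Sum>\<omega>\<in>cube L. exp (\<Sum>l\<in>L. (of_int (\<omega> l) - 1 / 2) * \<beta> l))
      = (\<Sum>\<omega>\<in>cube L. \<Prod>l\<in>L. exp ((of_int (\<omega> l) - 1 / 2) * \<beta> l))"
    using assms by (simp add: exp_sum)
  also have "\<dots> = (\<Prod>l\<in>L. exp ((of_int 0 - 1/2) * \<beta> l) + exp ((of_int 1 - 1/2) * \<beta> l))"
    by (rule sum_cube_prod[OF assms])
  also have "\<dots> = (\<Prod>l\<in>L. 2 * cosh (\<beta> l / 2))"
    by (intro prod.cong refl) (simp add: cosh_field_def)
  also have "\<dots> \<le> (\<Prod>l\<in>L. 2 * exp ((\<beta> l)^2 / 8))"
    using cosh_le_exp_half_square[of "\<beta> _ / 2"]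
    by (intro prod_mono) (auto simp: power_divide less_imp_le[OF cosh_real_pos])
  also have "\<dots> = 2 ^ card L * exp ((\<Sum>l\<in>L. (\<beta> l)^2) / 8)"
    using assms by (simp add: prod.distrib exp_sum sum_divide_distrib)
  finally show ?thesis .
qed

lemma cmod_one_plus_cis: "cmod (1 + cis t) = 2 * \<bar>cos (t / 2)\<bar>"
proof -
  have "1 + cis t = cis (t/2) * (cis (t/2) + cis (-(t/2)))"
    by (simp add: distrib_left cis_mult)
  also have "cis (t/2) + cis (-(t/2)) = complex_of_real (2 * cos (t/2))"
    by (simp add: complex_eq_iff)
  finally show ?thesis by (simp add: norm_mult)
qed

text \<open>
  The characteristic function of a sum of independent bits factorizes, and each bit contributes
  \<open>|1 + exp (i \<beta>)| / 2 = |cos (\<beta> / 2)|\<close>.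
\<close>
lemma sum_cube_cos_le:
  fixes \<beta> :: "'l \<Rightarrow> real"
  assumes "finite L"
  shows "(\<Sum>\<omega>\<in>cube L. cos (\<alpha> + (\<Sum>l\<in>L. of_int (\<omega> l) * \<beta> l))) \<le> 2 ^ card L * (\<Prod>l\<in>L. \<bar>cos (\<beta> l / 2)\<bar>)"
proof -
  have cis_sum: "cis (\<Sum>l\<in>L. f l) = (\<Prod>l\<in>L. cis (f l))" for f :: "'l \<Rightarrow> real"
    using assms by (induction rule: finite_induct) (auto simp: cis_mult[symmetric])
  have "(\<Sum>\<omega>\<in>cube L. cos (\<alpha> + (\<Sum>l\<in>L. of_int (\<omega> l) * \<beta> l)))
      = Re (\<Sum>\<omega>\<in>cube L. cis (\<alpha> + (\<Sum>l\<in>L. of_int (\<omega> l) * \<beta> l)))"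
    by simp
  also have "\<dots> \<le> cmod (\<Sum>\<omega>\<in>cube L. cis (\<alpha> + (\<Sum>l\<in>L. of_int (\<omega> l) * \<beta> l)))"
    by (rule complex_Re_le_cmod)
  also have "(\<Sum>\<omega>\<in>cube L. cis (\<alpha> + (\<Sum>l\<in>L. of_int (\<omega> l) * \<beta> l)))
      = cis \<alpha> * (\<Sum>\<omega>\<in>cube L. \<Prod>l\<in>L. cis (of_int (\<omega> l) * \<beta> l))"
    by (simp add: cis_mult[symmetric] cis_sum sum_distrib_left)
  also have "(\<Sum>\<omega>\<in>cube L. \<Prod>l\<in>L. cis (of_int (\<omega> l) * \<beta> l)) = (\<Prod>l\<in>L. cis (of_int 0 * \<beta> l) + cis (of_int 1 * \<beta> l))"
    by (rule sum_cube_prod[OF assms])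
  also have "cmod (cis \<alpha> * \<dots>) = (\<Prod>l\<in>L. 2 * \<bar>cos (\<beta> l / 2)\<bar>)"
    by (simp add: norm_mult prod_norm[symmetric] cmod_one_plus_cis)
  also have "\<dots> = 2 ^ card L * (\<Prod>l\<in>L. \<bar>cos (\<beta> l / 2)\<bar>)"
    by (simp add: prod.distrib)
  finally show ?thesis .
qed

definition residue_vectors :: "nat \<Rightarrow> int \<Rightarrow> (nat \<Rightarrow> int) set" where
  "residue_vectors n p = PiE {..<n} (\<lambda>_. {0..<p})"

lemma finite_residue_vectors: "finite (residue_vectors n p)"
  unfolding residue_vectors_def by (intro finite_PiE) auto

lemma card_residue_vectors: "p > 0 \<Longrightarrow> card (residue_vectors n p) = nat p ^ n"
  unfolding residue_vectors_def by (simp add: card_PiE)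

lemma sum_roots_of_unity:
  fixes p u :: int
  assumes p: "p > 0"
  shows "(\<Sum>r\<in>{0..<p}. cis (2 * pi * of_int (r * u) / of_int p)) = (if p dvd u then of_int p else 0)"
proof -
  define w where "w = cis (2 * pi * of_int u / of_int p)"
  have "(\<Sum>r\<in>{0..<p}. cis (2 * pi * of_int (r * u) / of_int p)) = (\<Sum>k<nat p. cis (2 * pi * of_int (int k * u) / of_int p))"
  proof (rule sum.reindex_bij_witness[of _ int nat])
  qed (use p in auto)
  also have "\<dots> = (\<Sum>k<nat p. w ^ k)"
    unfolding w_def by (intro sum.cong refl) (simp add: DeMoivre mult_ac)
  finally have eq: "(\<Sum>r\<in>{0..<p}. cis (2 * pi * of_int (r * u) / of_int p)) = (\<Sum>k<nat p. w ^ k)" .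
  have "w ^ nat p = cis (2 * pi * of_int u)"
    unfolding w_def using p by (simp add: DeMoivre)
  also have "\<dots> = 1" by (intro cis_multiple_2pi) auto
  finally have wp: "w ^ nat p = 1" .
  show ?thesis
  proof (cases "p dvd u")
    case True
    then obtain k where "u = p * k" by blast
    then have "2 * pi * of_int u / of_int p = 2 * pi * of_int k" using p by simp
    then have "w = cis (2 * pi * of_int k)" unfolding w_def by (rule arg_cong)
    also have "\<dots> = 1" by (rule cis_multiple_2pi) simp
    finally have "w = 1" .
    then show ?thesis using eq True p by simp
  next
    case False
    have "w \<noteq> 1"
    proof
      assume "w = 1"
      then have "cos (2 * pi * of_int u / of_int p) = 1" unfolding w_def by (simp add: complex_eq_iff)
      then obtain k :: int where "2 * pi * of_int u / of_int p = of_int k * 2 * pi"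
        using cos_one_2pi_int by auto
      then have "(of_int u :: real) = of_int (k * p)" using p by (simp add: field_simps)
      then have "u = k * p" by linarith
      with False show False by simp
    qed
    then show ?thesis using eq False wp by (simp add: sum_gp_strict)
  qed
qed

lemma character_orthogonality:
  fixes p :: int and u :: "nat \<Rightarrow> int"
  assumes p: "p > 0"
  shows "(\<Sum>v\<in>residue_vectors n p. cos (2 * pi * of_int (\<Sum>a<n. v a * u a) / of_int p))
       = (if \<forall>a<n. p dvd u a then of_int p ^ n else 0)"
proof -
  have cis_sum: "cis (\<Sum>l<n. f l) = (\<Prod>l<n. cis (f l))" for f
    by (induction n) (auto simp: cis_mult[symmetric])
  have "(\<Sum>v\<in>residue_vectors n p. cos (2 * pi * of_int (\<Sum>a<n. v a * u a) / of_int p))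
      = Re (\<Sum>v\<in>residue_vectors n p. cis (\<Sum>a<n. 2 * pi * of_int (v a * u a) / of_int p))"
    by (simp add: sum_divide_distrib sum_distrib_left)
  also have "(\<Sum>v\<in>residue_vectors n p. cis (\<Sum>a<n. 2 * pi * of_int (v a * u a) / of_int p))
     = (\<Prod>a<n. \<Sum>r\<in>{0..<p}. cis (2 * pi * of_int (r * u a) / of_int p))"
    unfolding residue_vectors_def cis_sum by (subst prod_sum_PiE) auto
  also have "\<dots> = (\<Prod>a<n. if p dvd u a then of_int p else 0)"
    by (intro prod.cong refl sum_roots_of_unity p)
  also have "\<dots> = (if \<forall>a<n. p dvd u a then of_int p ^ n else 0)"
    by (auto intro!: prod.neutral simp: prod_zero_iff)
  also have "Re \<dots> = (if \<forall>a<n. p dvd u a then of_int p ^ n else 0)"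
    by (auto simp flip: of_int_power)
  finally show ?thesis .
qed

text \<open>
  Fourier inversion on \<open>(\<int>/p)\<^sup>n\<close>: the number of cube points whose image is congruent to a given
  \<open>y\<close> is an average over characters \<open>v\<close>, the trivial one giving the equidistributed value and the
  others the error.  Taking absolute values makes the bound independent of \<open>y\<close>.
\<close>
lemma cube_fibre_bound:
  fixes \<zeta> :: "'l \<Rightarrow> nat \<Rightarrow> int" and p :: int
  assumes L: "finite L" and p: "p > 0"
  shows "real (card {\<omega>\<in>cube L. \<forall>a<n. p dvd (\<Sum>l\<in>L. \<omega> l * \<zeta> l a) - y a}) * of_int p ^ n
    \<le> 2 ^ card L * (\<Sum>v\<in>residue_vectors n p. \<Prod>l\<in>L. \<bar>cos (pi * of_int (\<Sum>a<n. v a * \<zeta> l a) / of_int p)\<bar>)"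
proof -
  let ?u = "\<lambda>\<omega> a. (\<Sum>l\<in>L. \<omega> l * \<zeta> l a) - y a"
  let ?V = "residue_vectors n p"
  have lin: "2 * pi * of_int (\<Sum>a<n. v a * ?u \<omega> a) / of_int p
     = - (2 * pi * of_int (\<Sum>a<n. v a * y a) / of_int p)
       + (\<Sum>l\<in>L. of_int (\<omega> l) * (2 * pi * of_int (\<Sum>a<n. v a * \<zeta> l a) / of_int p))" for \<omega> v
  proof -
    have "(\<Sum>a<n. v a * ?u \<omega> a) = (\<Sum>a<n. \<Sum>l\<in>L. \<omega> l * (v a * \<zeta> l a)) - (\<Sum>a<n. v a * y a)"
      by (simp add: right_diff_distrib sum_subtractf sum_distrib_left mult_ac)
    also have "(\<Sum>a<n. \<Sum>l\<in>L. \<omega> l * (v a * \<zeta> l a)) = (\<Sum>l\<in>L. \<omega> l * (\<Sum>a<n. v a * \<zeta> l a))"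
      by (subst sum.swap) (simp add: sum_distrib_left)
    finally have *: "(\<Sum>a<n. v a * ?u \<omega> a) = (\<Sum>l\<in>L. \<omega> l * (\<Sum>a<n. v a * \<zeta> l a)) - (\<Sum>a<n. v a * y a)" .
    define c where "c l = (\<Sum>a<n. v a * \<zeta> l a)" for l
    show ?thesis unfolding * c_def[symmetric] of_int_diff of_int_sum[of _ L]
      by (simp add: right_diff_distrib diff_divide_distrib sum_divide_distrib sum_distrib_left mult_ac)
  qed
  have "real (card {\<omega>\<in>cube L. \<forall>a<n. p dvd ?u \<omega> a}) * of_int p ^ n
      = (\<Sum>\<omega>\<in>cube L. if \<forall>a<n. p dvd ?u \<omega> a then of_int p ^ n else 0)"
    using finite_cube[OF L] by (subst sum.inter_filter[symmetric]) auto
  also have "\<dots> = (\<Sum>\<omega>\<in>cube L. \<Sum>v\<in>?V. cos (2 * pi * of_int (\<Sum>a<n. v a * ?u \<omega> a) / of_int p))"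
    by (intro sum.cong refl character_orthogonality[OF p, symmetric])
  also have "\<dots> = (\<Sum>v\<in>?V. \<Sum>\<omega>\<in>cube L. cos (2 * pi * of_int (\<Sum>a<n. v a * ?u \<omega> a) / of_int p))"
    by (rule sum.swap)
  also have "\<dots> \<le> (\<Sum>v\<in>?V. 2 ^ card L * (\<Prod>l\<in>L. \<bar>cos ((2 * pi * of_int (\<Sum>a<n. v a * \<zeta> l a) / of_int p) / 2)\<bar>))"
    unfolding lin by (intro sum_mono sum_cube_cos_le L)
  also have "\<dots> = 2 ^ card L * (\<Sum>v\<in>?V. \<Prod>l\<in>L. \<bar>cos (pi * of_int (\<Sum>a<n. v a * \<zeta> l a) / of_int p)\<bar>)"
  proof -
    have half: "(2 * pi * x / of_int p) / 2 = pi * x / of_int p" for x :: real by simp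
    show ?thesis unfolding half sum_distrib_left[symmetric] ..
  qed
  finally show ?thesis .
qed

section \<open>Theta sums of vectors in general position modulo a prime\<close>

definition dist_to_multiples :: "int \<Rightarrow> int \<Rightarrow> int" where
  "dist_to_multiples p b = min (b mod p) (p - b mod p)"

lemma dist_to_multiples_nonneg: "p > 0 \<Longrightarrow> dist_to_multiples p b \<ge> 0"
  unfolding dist_to_multiples_def using pos_mod_bound[of p b] pos_mod_sign[of p b] by linarith

lemma dist_to_multiples_pos_iff: "p > 0 \<Longrightarrow> dist_to_multiples p b \<ge> 1 \<longleftrightarrow> \<not> p dvd b"
  unfolding dist_to_multiples_def dvd_eq_mod_eq_0 using pos_mod_bound[of p b] pos_mod_sign[of p b] by linarith

lemma dist_to_multiples_mod: "dist_to_multiples p (b mod p) = dist_to_multiples p b"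
  unfolding dist_to_multiples_def by simp

lemma Jordan_inequality:
  assumes "0 \<le> x" "x \<le> pi / 2"
  shows "sin x \<ge> 2 * x / pi"
proof -
  have "convex_on {0..pi} (\<lambda>x. - sin x)"
    by (rule f''_ge0_imp_convex[where f' = "\<lambda>x. - cos x" and f'' = sin])
       (auto intro!: derivative_eq_intros sin_ge_zero)
  then have "- sin ((1 - 2 * x / pi) *\<^sub>R 0 + (2 * x / pi) *\<^sub>R (pi/2)) \<le> (1 - 2 * x / pi) * (- sin 0) + (2 * x / pi) * (- sin (pi/2))"
    using assms by (intro convex_onD) (auto simp: field_simps)
  then show ?thesis by simp
qed

text \<open>
  Modulo \<open>p\<close> only the distance to the multiples of \<open>p\<close> matters, which moves the argument into
  \<open>{0..pi / 2}\<close>; there \<open>cos\<^sup>2 = 1 - sin\<^sup>2\<close> and the chord bound for the sine apply.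
\<close>
lemma abs_cos_le_exp:
  fixes p b :: int
  assumes p: "p > 0"
  shows "\<bar>cos (pi * of_int b / of_int p)\<bar> \<le> exp (- 2 * (of_int (dist_to_multiples p b) / of_int p)^2)"
proof -
  define r where "r = b mod p"
  define q where "q = b div p"
  define a where "a = dist_to_multiples p b"
  have r: "0 \<le> r" "r < p" unfolding r_def using p by auto
  have b: "b = p * q + r" unfolding r_def q_def by simp
  have "pi * of_int b / of_int p = pi * of_int r / of_int p + of_int q * pi"
    unfolding b using p by (simp add: field_simps)
  moreover have "\<bar>cos (t + of_int q * pi)\<bar> = \<bar>cos t\<bar>" for t
    using cos_npi_int[of q] sin_npi_int[of q] by (simp add: cos_add abs_mult mult.commute[of _ pi])
  ultimately have 1: "\<bar>cos (pi * of_int b / of_int p)\<bar> = \<bar>cos (pi * of_int r / of_int p)\<bar>" by simp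
  have 2: "\<bar>cos (pi * of_int r / of_int p)\<bar> = \<bar>cos (pi * of_int a / of_int p)\<bar>"
  proof (cases "r \<le> p - r")
    case True then show ?thesis unfolding a_def dist_to_multiples_def r_def[symmetric] by simp
  next
    case False
    then have "a = p - r" unfolding a_def dist_to_multiples_def r_def[symmetric] by simp
    then have "pi * of_int a / of_int p = pi - pi * of_int r / of_int p"
      using p by (simp add: right_diff_distrib diff_divide_distrib)
    then show ?thesis by simp
  qed
  have a: "0 \<le> a" "2 * a \<le> p" unfolding a_def dist_to_multiples_def r_def[symmetric] using r by (auto simp: min_def)
  define x where "x = pi * of_int a / of_int p"
  have x: "0 \<le> x" "x \<le> pi / 2"
  proof -
    show "0 \<le> x" unfolding x_def using a p by simp
    have "2 * real_of_int a \<le> of_int p" using a by linarith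
    then have "of_int a / of_int p \<le> (1/2::real)" using p by (simp add: field_simps)
    then have "pi * (of_int a / of_int p) \<le> pi * (1/2)" by (intro mult_left_mono) auto
    then show "x \<le> pi / 2" unfolding x_def by simp
  qed
  have "sin x \<ge> 2 * (of_int a / of_int p)"
    using Jordan_inequality[OF x] unfolding x_def by simp
  then have "(sin x)^2 \<ge> (2 * (of_int a / of_int p))^2"
    using a p by (intro power_mono) auto
  then have "(cos x)^2 \<le> 1 + - 4 * (of_int a / of_int p)^2"
    unfolding power_mult_distrib power2_eq_square using sin_cos_squared_add3[of x] by linarith
  also have "\<dots> \<le> exp (- 4 * (of_int a / of_int p)^2)" by (rule exp_ge_add_one_self)
  also have "\<dots> = (exp (- 2 * (of_int a / of_int p)^2))^2"
    by (simp flip: exp_double)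
  finally have "\<bar>cos x\<bar> \<le> exp (- 2 * (of_int a / of_int p)^2)"
    by (simp add: abs_le_square_iff[symmetric])
  then show ?thesis using 1 2 unfolding x_def a_def by simp
qed

lemma sum_exp_dist_to_multiples_le:
  fixes p :: int
  assumes p: "p > 0"
  shows "(\<Sum>r\<in>{0..<p}. exp (- 2 * real_of_int (dist_to_multiples p r))) \<le> 2"
proof -
  have e2: "exp (-2::real) \<le> 1/4"
  proof -
    have "exp (1::real) \<ge> 2" using exp_ge_add_one_self[of 1] by simp
    then have "exp (1::real) * exp 1 \<ge> 2 * 2" by (intro mult_mono) auto
    then show ?thesis by (simp add: exp_minus mult_exp_exp field_simps)
  qed
  have e: "exp (-2 * real k) \<le> (1/4)^k" for k
  proof -
    have "exp (-2 * real k) = exp (-2) ^ k" by (simp add: exp_of_nat_mult[symmetric] mult.commute)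
    then show ?thesis using e2 by (simp add: power_mono)
  qed
  have geo: "(\<Sum>k<N. (1/4::real)^Suc k) \<le> 1/3" for N
  proof -
    have "(\<Sum>k<N. (1/4::real)^Suc k) = (1 - (1/4)^N) / 3"
    proof (induction N)
      case (Suc N)
      show ?case unfolding sum.lessThan_Suc Suc by (simp add: diff_divide_distrib)
    qed simp
    then show ?thesis by simp
  qed
  obtain N where N: "p = int (Suc N)" using p by (metis gr0_implies_Suc pos_int_cases)
  have "(\<Sum>r\<in>{0..<p}. exp (- 2 * real_of_int (dist_to_multiples p r))) = (\<Sum>k<Suc N. exp (- 2 * real_of_int (dist_to_multiples p (int k))))"
    unfolding N by (rule sum.reindex_bij_witness[of _ int nat]) auto
  also have "\<dots> = exp (- 2 * real_of_int (dist_to_multiples p 0)) + (\<Sum>k<N. exp (- 2 * real_of_int (dist_to_multiples p (int (Suc k)))))"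
    by (subst sum.lessThan_Suc_shift) simp
  also have "\<dots> \<le> 1 + (\<Sum>k<N. (1/4)^Suc k + (1/4)^Suc (N - Suc k))"
  proof (intro add_mono sum_mono)
    show "exp (- 2 * real_of_int (dist_to_multiples p 0)) \<le> 1" unfolding dist_to_multiples_def using p by simp
    fix k assume k: "k \<in> {..<N}"
    have "dist_to_multiples p (int (Suc k)) = int (Suc k) \<or> dist_to_multiples p (int (Suc k)) = int (Suc (N - Suc k))"
      using k unfolding dist_to_multiples_def N by auto
    then show "exp (- 2 * real_of_int (dist_to_multiples p (int (Suc k)))) \<le> (1/4)^Suc k + (1/4)^Suc (N - Suc k)"
    proof
      assume "dist_to_multiples p (int (Suc k)) = int (Suc k)"
      then have "exp (- 2 * real_of_int (dist_to_multiples p (int (Suc k)))) \<le> (1/4)^Suc k"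
        using e[of "Suc k"] by simp
      then show ?thesis by (rule order_trans) simp
    next
      assume "dist_to_multiples p (int (Suc k)) = int (Suc (N - Suc k))"
      then have "exp (- 2 * real_of_int (dist_to_multiples p (int (Suc k)))) \<le> (1/4)^Suc (N - Suc k)"
        using e[of "Suc (N - Suc k)"] by simp
      then show ?thesis by (rule order_trans) simp
    qed
  qed
  also have "\<dots> = 1 + ((\<Sum>k<N. (1/4)^Suc k) + (\<Sum>k<N. (1/4)^Suc (N - Suc k)))"
    by (simp only: sum.distrib)
  also have "(\<Sum>k<N. (1/4)^Suc (N - Suc k)) = (\<Sum>k<N. (1/4::real)^Suc k)"
    by (rule sum.nat_diff_reindex)
  finally show ?thesis using geo[of N] by linarith
qed

text \<open>
  The vectors indexed by \<open>T\<close> have an integral left inverse up to the factor \<open>d\<close>; for \<open>n\<close> linearly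
  independent vectors it is the adjugate matrix, with \<open>d\<close> the determinant.  Such an identity
  survives reduction modulo any prime that does not divide \<open>d\<close>.
\<close>
definition integral_frame :: "nat \<Rightarrow> 'i set \<Rightarrow> ('i \<Rightarrow> nat \<Rightarrow> int) \<Rightarrow> int \<Rightarrow> bool" where
  "integral_frame n T z d \<longleftrightarrow>
     (\<exists>c. \<forall>a<n. \<forall>b<n. (\<Sum>i\<in>T. c a i * z i b) = (if a = b then d else (0::int)))"

lemma integral_frame_dvd:
  assumes "integral_frame n T z d" and p: "prime p" "\<not> p dvd d"
    and dvd: "\<And>i. i \<in> T \<Longrightarrow> p dvd (\<Sum>b<n. v b * z i b)" and a: "a < n"
  shows "p dvd (v a :: int)"
proof -
  obtain c where c: "\<And>a b. a < n \<Longrightarrow> b < n \<Longrightarrow> (\<Sum>i\<in>T. c a i * z i b) = (if a = b then d else 0)"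
    using assms(1) unfolding integral_frame_def by blast
  have "(\<Sum>i\<in>T. c a i * (\<Sum>b<n. v b * z i b)) = (\<Sum>b<n. v b * (\<Sum>i\<in>T. c a i * z i b))"
    unfolding sum_distrib_left by (subst sum.swap) (simp add: mult_ac)
  also have "\<dots> = (\<Sum>b<n. v b * (if a = b then d else 0))"
    using c a by (intro sum.cong refl) auto
  also have "\<dots> = v a * d" using a by (simp add: if_distrib cong: if_cong)
  finally have "(\<Sum>i\<in>T. c a i * (\<Sum>b<n. v b * z i b)) = v a * d" .
  moreover have "p dvd (\<Sum>i\<in>T. c a i * (\<Sum>b<n. v b * z i b))"
    using dvd by (intro dvd_sum) auto
  ultimately have "p dvd v a * d" by simp
  then show ?thesis using p by (simp add: prime_dvd_mult_iff)
qed

lemma residue_vectors_eqI: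
  assumes "v \<in> residue_vectors n p" "w \<in> residue_vectors n p" "\<And>a. a < n \<Longrightarrow> p dvd v a - w a"
  shows "v = w"
proof (rule PiE_ext[OF assms(1,2)[unfolded residue_vectors_def]])
  fix a assume a: "a \<in> {..<n}"
  have "v a \<in> {0..<p}" "w a \<in> {0..<p}"
    using PiE_mem[OF assms(1)[unfolded residue_vectors_def] a] PiE_mem[OF assms(2)[unfolded residue_vectors_def] a] .
  then have "v a mod p = v a" "w a mod p = w a" by auto
  moreover have "v a mod p = w a mod p" using assms(3)[of a] a by (intro mod_eq_dvd_iff[THEN iffD2]) simp
  ultimately show "v a = w a" by linarith
qed

text \<open>
  Modulo \<open>p\<close> a residue vector is determined by its inner products with a basis, so the sum is at
  most one over all tuples of residues, and that one is a product of one-dimensional sums.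
\<close>
lemma basis_theta_le:
  fixes z :: "'i \<Rightarrow> nat \<Rightarrow> int"
  assumes T: "finite T" "integral_frame n T z d" and p: "prime p" "\<not> p dvd d"
  shows "(\<Sum>v\<in>residue_vectors n p. exp (- 2 * (\<Sum>i\<in>T. real_of_int (dist_to_multiples p (\<Sum>b<n. v b * z i b))))) \<le> 2 ^ card T"
proof -
  have p0: "p > 0" using p(1) by (simp add: prime_gt_0_int)
  define h where "h v = (\<lambda>i\<in>T. (\<Sum>b<n. v b * z i b) mod p)" for v
  let ?V = "residue_vectors n p"
  let ?W = "PiE T (\<lambda>_. {0..<p})"
  let ?g = "\<lambda>w. \<Prod>i\<in>T. exp (- 2 * real_of_int (dist_to_multiples p (w i)))"
  have inj: "inj_on h ?V"
  proof (rule inj_onI)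
    fix v w assume vw: "v \<in> ?V" "w \<in> ?V" and eq: "h v = h w"
    have "p dvd (\<Sum>b<n. (v b - w b) * z i b)" if "i \<in> T" for i
    proof -
      have "(\<Sum>b<n. v b * z i b) mod p = (\<Sum>b<n. w b * z i b) mod p"
        using fun_cong[OF eq, of i] that unfolding h_def by simp
      then have "p dvd (\<Sum>b<n. v b * z i b) - (\<Sum>b<n. w b * z i b)" by (rule mod_eq_dvd_iff[THEN iffD1])
      then show ?thesis by (simp add: left_diff_distrib sum_subtractf)
    qed
    then have "p dvd v a - w a" if "a < n" for a
      using integral_frame_dvd[OF T(2) p, of "\<lambda>b. v b - w b" a] that by blast
    then show "v = w" using residue_vectors_eqI[OF vw] by blast
  qed
  have sub: "h ` ?V \<subseteq> ?W" unfolding h_def using p0 by auto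
  have "(\<Sum>v\<in>?V. exp (- 2 * (\<Sum>i\<in>T. real_of_int (dist_to_multiples p (\<Sum>b<n. v b * z i b))))) = (\<Sum>v\<in>?V. ?g (h v))"
    using T(1) by (intro sum.cong refl) (simp add: sum_distrib_left exp_sum h_def dist_to_multiples_mod)
  also have "\<dots> = (\<Sum>w\<in>h ` ?V. ?g w)" using inj by (simp add: sum.reindex)
  also have "\<dots> \<le> (\<Sum>w\<in>?W. ?g w)"
    using sub T(1) by (intro sum_mono2 finite_PiE prod_nonneg) auto
  also have "\<dots> = (\<Prod>i\<in>T. \<Sum>r\<in>{0..<p}. exp (- 2 * real_of_int (dist_to_multiples p r)))"
    using T(1) by (subst prod_sum_PiE) auto
  also have "\<dots> \<le> (\<Prod>i\<in>T. 2)"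
    using sum_exp_dist_to_multiples_le[OF p0] by (intro prod_mono) (auto intro!: sum_nonneg)
  finally show ?thesis by simp
qed

lemma exp_mean_le_mean_exp:
  fixes x :: "nat \<Rightarrow> real"
  assumes k: "k > 0"
  shows "exp ((\<Sum>j<k. x j) / real k) \<le> (\<Sum>j<k. exp (x j)) / real k"
proof -
  define m where "m = (\<Sum>j<k. x j) / real k"
  have "exp m * (1 + (x j - m)) \<le> exp (x j)" for j
  proof -
    have "exp m * (1 + (x j - m)) \<le> exp m * exp (x j - m)"
      by (intro mult_left_mono exp_ge_add_one_self) auto
    then show ?thesis by (simp add: mult_exp_exp)
  qed
  then have "(\<Sum>j<k. exp m * (1 + (x j - m))) \<le> (\<Sum>j<k. exp (x j))" by (intro sum_mono)
  moreover have "(\<Sum>j<k. exp m * (1 + (x j - m))) = exp m * real k"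
    using k by (simp add: sum_distrib_left[symmetric] sum.distrib sum_subtractf m_def)
  ultimately show ?thesis using k unfolding m_def[symmetric] by (simp add: field_simps)
qed

lemma disjoint_blocks:
  assumes I: "finite I"
  obtains T :: "nat \<Rightarrow> 'i set" where
    "\<And>j. j < card I div n \<Longrightarrow> T j \<subseteq> I \<and> card (T j) = n"
    "\<And>f :: 'i \<Rightarrow> real. (\<And>i. i \<in> I \<Longrightarrow> f i \<ge> 0) \<Longrightarrow> (\<Sum>j<card I div n. sum f (T j)) \<le> sum f I"
proof -
  obtain h where h: "bij_betw h {..<card I} I"
    using ex_bij_betw_nat_finite[OF I] by (auto simp: lessThan_atLeast0)
  have inj: "inj_on h {..<card I}" and im: "h ` {..<card I} = I" using h by (auto simp: bij_betw_def)
  define T where "T j = h ` {j * n..<j * n + n}" for j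
  have range: "{j * n..<j * n + n} \<subseteq> {..<card I}" if "j < card I div n" for j
  proof -
    have "Suc j * n \<le> (card I div n) * n" using that by (intro mult_le_mono1) simp
    also have "\<dots> \<le> card I" by (metis div_times_less_eq_dividend)
    finally show ?thesis by auto
  qed
  show thesis
  proof (rule that)
    show "T j \<subseteq> I \<and> card (T j) = n" if "j < card I div n" for j
      unfolding T_def using range[OF that] im inj
      by (auto simp: card_image[OF inj_on_subset[OF inj range[OF that]]])
  next
    fix f :: "'i \<Rightarrow> real" assume f: "\<And>i. i \<in> I \<Longrightarrow> f i \<ge> 0"
    have "(\<Sum>j<card I div n. sum f (T j)) = (\<Sum>j<card I div n. \<Sum>i\<in>{j * n..<j * n + n}. f (h i))"
      unfolding T_def by (intro sum.cong refl sum.reindex[unfolded comp_def] inj_on_subset[OF inj range]) auto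
    also have "\<dots> = (\<Sum>i<(card I div n) * n. f (h i))"
      by (rule sum.nat_group)
    also have "\<dots> \<le> (\<Sum>i<card I. f (h i))"
      using f im by (intro sum_mono2) (auto simp: div_times_less_eq_dividend intro: less_le_trans)
    also have "\<dots> = sum f I" using sum.reindex_bij_betw[OF h] by simp
    finally show "(\<Sum>j<card I div n. sum f (T j)) \<le> sum f I" .
  qed
qed

text \<open>
  With \<open>k = card I div n\<close> disjoint bases one has \<open>n k \<ge> D\<close>.  Hence the exponent is at most the mean
  over these bases of \<open>- 2\<close> times the sum over the basis, and by convexity of the exponential the
  total is at most the mean of the sums in \<open>basis_theta_le\<close>.
\<close>
lemma theta_sum_le:
  fixes z :: "'i \<Rightarrow> nat \<Rightarrow> int" and D :: real
  assumes I: "finite I" "n \<le> card I" and n: "n > 0" and D: "D = real (card I) - real n + 1"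
    and frame: "\<And>T. T \<subseteq> I \<Longrightarrow> card T = n \<Longrightarrow> \<exists>d. integral_frame n T z d \<and> \<not> p dvd d"
    and p: "prime p"
  shows "(\<Sum>v\<in>residue_vectors n p.
            exp (- 2 * real n / D * (\<Sum>i\<in>I. real_of_int (dist_to_multiples p (\<Sum>b<n. v b * z i b))))) \<le> 2 ^ n"
proof -
  let ?V = "residue_vectors n p"
  define f where "f v i = real_of_int (dist_to_multiples p (\<Sum>b<n. v b * z i b))" for v i
  have p0: "p > 0" using p by (simp add: prime_gt_0_int)
  have f0: "f v i \<ge> 0" for v i unfolding f_def using dist_to_multiples_nonneg[OF p0] by simp
  define k where "k = card I div n"
  have k: "k > 0" unfolding k_def using I n by (simp add: div_greater_zero_iff)
  obtain T where T: "\<And>j. j < k \<Longrightarrow> T j \<subseteq> I \<and> card (T j) = n"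
    and Tsum: "\<And>f :: 'i \<Rightarrow> real. (\<And>i. i \<in> I \<Longrightarrow> f i \<ge> 0) \<Longrightarrow> (\<Sum>j<k. sum f (T j)) \<le> sum f I"
    using disjoint_blocks[OF I(1), of n] unfolding k_def by blast
  have D0: "D > 0" using D I by simp
  have "card I < k * n + n" unfolding k_def using n
    by (metis add.commute dividend_less_div_times)
  then have "card I + 1 \<le> k * n + n" by simp
  then have "real (card I + 1) \<le> real (k * n + n)" by (rule of_nat_mono)
  then have "real (card I) + 1 \<le> real k * real n + real n" by simp
  then have kn: "D \<le> real n * real k" unfolding D by (simp add: mult.commute)
  have one: "(\<Sum>v\<in>?V. exp (- 2 * sum (f v) (T j))) \<le> 2 ^ n" if "j < k" for j
  proof -
    have Tj: "T j \<subseteq> I" "card (T j) = n" using T[OF that] by auto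
    obtain d where d: "integral_frame n (T j) z d" "\<not> p dvd d" using frame[OF Tj] by blast
    show ?thesis
      using basis_theta_le[OF finite_subset[OF Tj(1) I(1)] d(1) p d(2)] Tj(2)
      unfolding f_def by simp
  qed
  have "(\<Sum>v\<in>?V. exp (- 2 * real n / D * sum (f v) I)) \<le> (\<Sum>v\<in>?V. (\<Sum>j<k. exp (- 2 * sum (f v) (T j))) / real k)"
  proof (rule sum_mono)
    fix v
    have "(\<Sum>j<k. sum (f v) (T j)) / real k \<le> sum (f v) I / real k"
      using Tsum[of "f v"] f0 by (intro divide_right_mono) auto
    also have "\<dots> = (1 / real k) * sum (f v) I" by simp
    also have "\<dots> \<le> (real n / D) * sum (f v) I"
      using kn k D0 f0 by (intro mult_right_mono sum_nonneg) (auto simp: field_simps)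
    finally have le: "(\<Sum>j<k. sum (f v) (T j)) / real k \<le> (real n / D) * sum (f v) I" .
    have "(\<Sum>j<k. - 2 * sum (f v) (T j)) / real k = - 2 * ((\<Sum>j<k. sum (f v) (T j)) / real k)"
      unfolding sum_distrib_left[symmetric] by simp
    moreover have "- 2 * real n / D * sum (f v) I = - 2 * ((real n / D) * sum (f v) I)" by simp
    ultimately have "- 2 * real n / D * sum (f v) I \<le> (\<Sum>j<k. - 2 * sum (f v) (T j)) / real k"
      using le by linarith
    then have "exp (- 2 * real n / D * sum (f v) I) \<le> exp ((\<Sum>j<k. - 2 * sum (f v) (T j)) / real k)"
      by simp
    also have "\<dots> \<le> (\<Sum>j<k. exp (- 2 * sum (f v) (T j))) / real k"
      by (rule exp_mean_le_mean_exp[OF k])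
    finally show "exp (- 2 * real n / D * sum (f v) I) \<le> (\<Sum>j<k. exp (- 2 * sum (f v) (T j))) / real k" .
  qed
  also have "\<dots> = (\<Sum>j<k. \<Sum>v\<in>?V. exp (- 2 * sum (f v) (T j))) / real k"
    by (subst sum.swap) (simp add: sum_divide_distrib)
  also have "\<dots> \<le> (\<Sum>j<k. 2 ^ n) / real k"
    using one by (intro divide_right_mono sum_mono) auto
  also have "\<dots> = 2 ^ n" using k by simp
  finally show ?thesis unfolding f_def .
qed

text \<open>
  The lattice width bound modulo \<open>p\<close>: if \<open>n\<close> of the inner products were divisible by \<open>p\<close>, then so
  would be all coordinates of \<open>v\<close>.
\<close>
lemma sum_dist_to_multiples_ge:
  fixes z :: "'i \<Rightarrow> nat \<Rightarrow> int"
  assumes I: "finite I" 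
    and frame: "\<And>T. T \<subseteq> I \<Longrightarrow> card T = n \<Longrightarrow> \<exists>d. integral_frame n T z d \<and> \<not> p dvd d"
    and p: "prime p" and v: "a < n" "\<not> p dvd v a"
  shows "(\<Sum>i\<in>I. real_of_int (dist_to_multiples p (\<Sum>b<n. v b * z i b))) \<ge> real (card I) - real n + 1"
proof -
  have p0: "p > 0" using p by (simp add: prime_gt_0_int)
  define Z where "Z = {i\<in>I. p dvd (\<Sum>b<n. v b * z i b)}"
  have "card Z < n"
  proof (rule ccontr)
    assume "\<not> card Z < n"
    then obtain T where T: "T \<subseteq> Z" "card T = n" using obtain_subset_with_card_n[of n Z] by auto
    then have "T \<subseteq> I" unfolding Z_def by auto
    then obtain d where "integral_frame n T z d" "\<not> p dvd d" using frame T by blast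
    then show False using integral_frame_dvd[of n T z d p v a] p v T unfolding Z_def by blast
  qed
  have "real (card (I - Z)) = (\<Sum>i\<in>I - Z. 1)" by simp
  also have "\<dots> \<le> (\<Sum>i\<in>I - Z. real_of_int (dist_to_multiples p (\<Sum>b<n. v b * z i b)))"
    using dist_to_multiples_pos_iff[OF p0] by (intro sum_mono) (auto simp: Z_def)
  also have "\<dots> \<le> (\<Sum>i\<in>I. real_of_int (dist_to_multiples p (\<Sum>b<n. v b * z i b)))"
    using I dist_to_multiples_nonneg[OF p0] by (intro sum_mono2) auto
  finally have 1: "real (card (I - Z)) \<le> (\<Sum>i\<in>I. real_of_int (dist_to_multiples p (\<Sum>b<n. v b * z i b)))" .
  have "card (I - Z) = card I - card Z" "card Z \<le> card I"
    using I by (auto simp: Z_def card_Diff_subset card_mono)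
  then have "real (card (I - Z)) = real (card I) - real (card Z)" by simp
  then show ?thesis using 1 \<open>card Z < n\<close> by linarith
qed

section \<open>Random lattice points with small coefficients\<close>

text \<open>
  The matrix \<open>R\<close> sends a coefficient vector \<open>x\<close> to one that represents the same point and minimizes
  \<open>\<Sum>\<^sub>i t\<^sub>i\<^sup>2 / s\<^sub>i\<close>.  For Lewis weights every row of \<open>R\<close> is bounded in the norm dual to this one.
\<close>
lemma balanced_right_inverse:
  fixes z :: "'i \<Rightarrow> nat \<Rightarrow> real"
  assumes fin: "finite I"
    and span: "\<And>v a. (\<And>i. i \<in> I \<Longrightarrow> dot n v (z i) = 0) \<Longrightarrow> a < n \<Longrightarrow> v a = 0"
    and nz: "\<And>i. i \<in> I \<Longrightarrow> \<exists>a<n. z i a \<noteq> 0"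
  obtains s :: "'i \<Rightarrow> real" and R :: "'i \<Rightarrow> 'i \<Rightarrow> real" where
    "\<And>i. i \<in> I \<Longrightarrow> s i > 0" "(\<Sum>i\<in>I. 1 / s i) \<le> 4 * real n"
    "\<And>j a. j \<in> I \<Longrightarrow> a < n \<Longrightarrow> (\<Sum>i\<in>I. R i j * z i a) = z j a"
    "\<And>i. i \<in> I \<Longrightarrow> (\<Sum>j\<in>I. s j * (R i j)^2) \<le> 4"
proof -
  have "\<exists>s y. dual_frame n I z s y \<and> (\<forall>i\<in>I. s i > 0) \<and>
           (\<forall>i\<in>I. (s i)^2 * dot n (z i) (y i) \<le> 4) \<and> (\<Sum>i\<in>I. 1 / s i) \<le> 4 * real n"
  proof (rule Lewis_weights_exist[OF fin])
    show "v a = 0" if "\<And>i. i \<in> I \<Longrightarrow> dot n v (z i) = 0" "a < n" for v a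
      using span that by blast
  qed (rule nz)
  then obtain s y where df: "dual_frame n I z s y" and pos: "\<forall>i\<in>I. s i > 0"
    and lev: "\<forall>i\<in>I. (s i)^2 * dot n (z i) (y i) \<le> 4" and tr: "(\<Sum>i\<in>I. 1 / s i) \<le> 4 * real n"
    by blast
  have sym: "dot n (z i) (y j) = dot n (z j) (y i)" if "i \<in> I" "j \<in> I" for i j
    using df that unfolding dual_frame_def by blast
  show thesis
  proof (rule that[of s "\<lambda>i j. s i * dot n (z j) (y i)"])
    show "(\<Sum>i\<in>I. s i * dot n (z j) (y i) * z i a) = z j a" if "a < n" for j a
      using dual_frame_reproduces[OF df that] .
    show "(\<Sum>j\<in>I. s j * (s i * dot n (z j) (y i))^2) \<le> 4" if i: "i \<in> I" for i
    proof -
      have "(\<Sum>j\<in>I. s j * (s i * dot n (z j) (y i))^2) = (s i)^2 * (\<Sum>j\<in>I. s j * (dot n (z j) (y i))^2)"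
        unfolding sum_distrib_left by (intro sum.cong refl) (simp add: power_mult_distrib mult_ac)
      then show ?thesis using lev i dual_frame_sum_squares[OF df i] by simp
    qed
  qed (use pos tr in auto)
qed

definition clip :: "real \<Rightarrow> real \<Rightarrow> real" where
  "clip c t = max (- c) (min c t)"

lemma abs_clip_le: "c \<ge> 0 \<Longrightarrow> \<bar>clip c t\<bar> \<le> c"
  unfolding clip_def by auto

text \<open>
  If \<open>u\<close> is the excess of \<open>|t|\<close> over the threshold in units of \<open>\<sigma>\<close>, then \<open>u\<^sup>2 / 2 \<le> exp u\<close>.
  Comparing with exponentials reduces the expected squared excess to exponential moments.
\<close>
lemma clip_excess_le:
  assumes \<sigma>: "\<sigma> > 0" and \<theta>: "\<theta> \<ge> 0"
  shows "(t - clip (\<theta> * \<sigma>) t)^2 \<le> 2 * \<sigma>^2 * exp (- \<theta>) * (exp (t / \<sigma>) + exp (- t / \<sigma>))"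
proof -
  define u where "u = \<bar>t - clip (\<theta> * \<sigma>) t\<bar> / \<sigma>"
  have u0: "u \<ge> 0" unfolding u_def using \<sigma> by simp
  have c0: "\<theta> * \<sigma> \<ge> 0" using assms by simp
  show ?thesis
  proof (cases "\<bar>t\<bar> \<le> \<theta> * \<sigma>")
    case True
    then have "clip (\<theta> * \<sigma>) t = t" unfolding clip_def by auto
    then show ?thesis by simp
  next
    case False
    then have "\<bar>t - clip (\<theta> * \<sigma>) t\<bar> = \<bar>t\<bar> - \<theta> * \<sigma>" using c0 unfolding clip_def by auto
    then have u: "u = \<bar>t\<bar> / \<sigma> - \<theta>" unfolding u_def using \<sigma> by (simp add: field_simps)
    have "u^2 / 2 \<le> exp u" using exp_lower_Taylor_quadratic[OF u0] u0 by simp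
    also have "\<dots> = exp (- \<theta>) * exp (\<bar>t\<bar> / \<sigma>)" unfolding u by (simp add: mult_exp_exp)
    also have "\<dots> \<le> exp (- \<theta>) * (exp (t / \<sigma>) + exp (- t / \<sigma>))"
      by (intro mult_left_mono) (cases "t \<ge> 0"; simp)+
    finally have "\<sigma>^2 * (u^2 / 2) \<le> \<sigma>^2 * (exp (- \<theta>) * (exp (t / \<sigma>) + exp (- t / \<sigma>)))"
      by (intro mult_left_mono) auto
    moreover have "(t - clip (\<theta> * \<sigma>) t)^2 = \<sigma>^2 * u^2"
      unfolding u_def using \<sigma> by (simp add: power_divide)
    ultimately show ?thesis by (simp add: mult_ac)
  qed
qed

definition bit_positions :: "'i set \<Rightarrow> ('i \<Rightarrow> nat) \<Rightarrow> ('i \<times> nat) set" where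
  "bit_positions I L = (SIGMA i:I. {..<L i})"

definition centred_count :: "('i \<Rightarrow> nat) \<Rightarrow> ('i \<times> nat \<Rightarrow> int) \<Rightarrow> 'i \<Rightarrow> real" where
  "centred_count L \<omega> i = (\<Sum>l<L i. (of_int (\<omega> (i, l)) - 1 / 2))"

lemma finite_bit_positions: "finite I \<Longrightarrow> finite (bit_positions I L)"
  unfolding bit_positions_def by auto

lemma sum_bit_positions:
  assumes "finite I"
  shows "(\<Sum>x\<in>bit_positions I L. f x) = (\<Sum>i\<in>I. \<Sum>l<L i. f (i, l))"
  unfolding bit_positions_def using assms by (subst sum.Sigma) auto

lemma centred_count_exp_moment:
  fixes \<beta> :: "'i \<Rightarrow> real"
  assumes I: "finite I" and var: "(\<Sum>i\<in>I. real (L i) * (\<beta> i)^2) \<le> 8"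
  shows "(\<Sum>\<omega>\<in>cube (bit_positions I L). exp (\<Sum>i\<in>I. \<beta> i * centred_count L \<omega> i)) \<le> 2 ^ card (bit_positions I L) * 3"
proof -
  let ?N = "(2::real) ^ card (bit_positions I L)"
  have eq: "(\<Sum>x\<in>bit_positions I L. (of_int (\<omega> x) - 1 / 2) * \<beta> (fst x)) = (\<Sum>i\<in>I. \<beta> i * centred_count L \<omega> i)" for \<omega>
    unfolding sum_bit_positions[OF I] centred_count_def sum_distrib_left by (simp add: mult.commute)
  have "(\<Sum>x\<in>bit_positions I L. (\<beta> (fst x))^2) = (\<Sum>i\<in>I. real (L i) * (\<beta> i)^2)"
    unfolding sum_bit_positions[OF I] by simp
  then have "exp ((\<Sum>x\<in>bit_positions I L. (\<beta> (fst x))^2) / 8) \<le> exp 1" using var by simp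
  also have "\<dots> \<le> 3" by (rule exp_le)
  finally have "?N * exp ((\<Sum>x\<in>bit_positions I L. (\<beta> (fst x))^2) / 8) \<le> ?N * 3"
    by (intro mult_left_mono) auto
  then show ?thesis
    using sum_cube_exp_le[OF finite_bit_positions[OF I, of L], of "\<lambda>x. \<beta> (fst x)"] unfolding eq by linarith
qed

text \<open>
  The coefficients \<open>t = R x\<close> of the random point are clipped at \<open>\<sigma> ln n\<close>, and the clipped-off part
  \<open>e\<close> is passed through \<open>R\<close> again.  Its weighted square norm \<open>W = \<Sum>\<^sub>i e\<^sub>i\<^sup>2 / s\<^sub>i\<close> has mean
  \<open>O(\<sigma>\<^sup>2 (\<Sum>\<^sub>i 1 / s\<^sub>i) / n)\<close>, the factor \<open>1 / n = exp (- ln n)\<close> coming from the threshold, and this is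
  \<open>O(\<sigma>\<^sup>2)\<close>.  The row bound on \<open>R\<close> turns it into a bound on every single coefficient.
\<close>
lemma centred_count_has_small_coefficients:
  fixes z :: "'i \<Rightarrow> nat \<Rightarrow> real" and s :: "'i \<Rightarrow> real" and R :: "'i \<Rightarrow> 'i \<Rightarrow> real"
  assumes I: "finite I" and n: "n > 0"
    and s: "\<And>i. i \<in> I \<Longrightarrow> s i > 0" "(\<Sum>i\<in>I. 1 / s i) \<le> 4 * real n"
    and R: "\<And>j a. j \<in> I \<Longrightarrow> a < n \<Longrightarrow> (\<Sum>i\<in>I. R i j * z i a) = z j a"
      "\<And>i. i \<in> I \<Longrightarrow> (\<Sum>j\<in>I. s j * (R i j)^2) \<le> 4"
    and \<sigma>: "\<sigma> > 0" and L: "\<And>i. i \<in> I \<Longrightarrow> real (L i) \<le> 2 * \<sigma>^2 * s i"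
  shows "real (card {\<omega>\<in>cube (bit_positions I L). \<exists>t. (\<forall>i\<in>I. \<bar>t i\<bar> \<le> (ln (real n) + 28) * \<sigma>) \<and>
           (\<forall>a<n. (\<Sum>i\<in>I. centred_count L \<omega> i * z i a) = (\<Sum>i\<in>I. t i * z i a))}) \<ge> 3 / 4 * 2 ^ card (bit_positions I L)"
proof -
  let ?\<Omega> = "cube (bit_positions I L)"
  let ?N = "(2::real) ^ card (bit_positions I L)"
  define \<theta> where "\<theta> = ln (real n)"
  have \<theta>: "\<theta> \<ge> 0" "exp (- \<theta>) = 1 / real n" unfolding \<theta>_def using n by (auto simp: exp_minus field_simps)
  define t where "t \<omega> i = (\<Sum>j\<in>I. R i j * centred_count L \<omega> j)" for \<omega> i
  define e where "e \<omega> i = t \<omega> i - clip (\<theta> * \<sigma>) (t \<omega> i)" for \<omega> i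
  define W where "W \<omega> = (\<Sum>i\<in>I. (e \<omega> i)^2 / s i)" for \<omega>
  have fin\<Omega>: "finite ?\<Omega>" using I by (intro finite_cube finite_bit_positions)
  have repr: "(\<Sum>i\<in>I. (\<Sum>j\<in>I. R i j * x j) * z i a) = (\<Sum>j\<in>I. x j * z j a)" if "a < n" for x a
  proof -
    have "(\<Sum>i\<in>I. (\<Sum>j\<in>I. R i j * x j) * z i a) = (\<Sum>j\<in>I. x j * (\<Sum>i\<in>I. R i j * z i a))"
      unfolding sum_distrib_left sum_distrib_right by (subst sum.swap) (simp add: mult_ac)
    also have "\<dots> = (\<Sum>j\<in>I. x j * z j a)" using R(1) that by (intro sum.cong refl) auto
    finally show ?thesis .
  qed
  have moment: "(\<Sum>\<omega>\<in>?\<Omega>. exp (t \<omega> i / \<sigma>)) \<le> ?N * 3" "(\<Sum>\<omega>\<in>?\<Omega>. exp (- t \<omega> i / \<sigma>)) \<le> ?N * 3" if i: "i \<in> I" for i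
  proof -
    have "(\<Sum>j\<in>I. real (L j) * (R i j / \<sigma>)^2) \<le> (\<Sum>j\<in>I. (2 * \<sigma>^2 * s j) * (R i j / \<sigma>)^2)"
      using L by (intro sum_mono mult_right_mono) auto
    also have "\<dots> = 2 * (\<Sum>j\<in>I. s j * (R i j)^2)"
      unfolding sum_distrib_left using \<sigma> by (intro sum.cong refl) (simp add: power_divide)
    also have "\<dots> \<le> 8" using R(2)[OF i] by simp
    finally have v: "(\<Sum>j\<in>I. real (L j) * (R i j / \<sigma>)^2) \<le> 8" .
    have "(\<Sum>j\<in>I. R i j / \<sigma> * centred_count L \<omega> j) = t \<omega> i / \<sigma>" for \<omega>
      unfolding t_def by (simp add: sum_divide_distrib)
    then show "(\<Sum>\<omega>\<in>?\<Omega>. exp (t \<omega> i / \<sigma>)) \<le> ?N * 3"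
      using centred_count_exp_moment[OF I v] by simp
    have "(\<Sum>j\<in>I. - (R i j / \<sigma>) * centred_count L \<omega> j) = - t \<omega> i / \<sigma>" for \<omega>
      unfolding t_def by (simp add: sum_divide_distrib sum_negf)
    then show "(\<Sum>\<omega>\<in>?\<Omega>. exp (- t \<omega> i / \<sigma>)) \<le> ?N * 3"
      using centred_count_exp_moment[OF I, of L "\<lambda>j. - (R i j / \<sigma>)"] v by simp
  qed
  have mean: "(\<Sum>\<omega>\<in>?\<Omega>. W \<omega>) \<le> 48 * \<sigma>^2 * ?N"
  proof -
    have "(\<Sum>\<omega>\<in>?\<Omega>. W \<omega>) = (\<Sum>i\<in>I. (1 / s i) * (\<Sum>\<omega>\<in>?\<Omega>. (e \<omega> i)^2))"
      unfolding W_def sum_distrib_left by (subst sum.swap) simp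
    also have "\<dots> \<le> (\<Sum>i\<in>I. (1 / s i) * (12 * \<sigma>^2 * ?N / real n))"
    proof (intro sum_mono mult_left_mono)
      fix i assume i: "i \<in> I"
      have "(\<Sum>\<omega>\<in>?\<Omega>. (e \<omega> i)^2) \<le> (\<Sum>\<omega>\<in>?\<Omega>. 2 * \<sigma>^2 * exp (- \<theta>) * (exp (t \<omega> i / \<sigma>) + exp (- t \<omega> i / \<sigma>)))"
        unfolding e_def by (intro sum_mono clip_excess_le \<sigma> \<theta>)
      also have "\<dots> = 2 * \<sigma>^2 / real n * ((\<Sum>\<omega>\<in>?\<Omega>. exp (t \<omega> i / \<sigma>)) + (\<Sum>\<omega>\<in>?\<Omega>. exp (- t \<omega> i / \<sigma>)))"
        by (simp only: sum_distrib_left[symmetric] sum.distrib \<theta>(2)) simp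
      also have "\<dots> \<le> 2 * \<sigma>^2 / real n * (?N * 3 + ?N * 3)"
        using moment[OF i] by (intro mult_left_mono add_mono) auto
      finally show "(\<Sum>\<omega>\<in>?\<Omega>. (e \<omega> i)^2) \<le> 12 * \<sigma>^2 * ?N / real n" by (simp add: field_simps)
    qed (use s in \<open>auto simp: less_imp_le\<close>)
    also have "\<dots> = (\<Sum>i\<in>I. 1 / s i) * (12 * \<sigma>^2 * ?N / real n)" by (rule sum_distrib_right[symmetric])
    also have "\<dots> \<le> (4 * real n) * (12 * \<sigma>^2 * ?N / real n)"
      using s(2) by (intro mult_right_mono) auto
    also have "\<dots> = 48 * \<sigma>^2 * ?N" using n by simp
    finally show ?thesis .
  qed
  \<comment> \<open>Four times the mean of \<open>W\<close>, so Markov's inequality leaves at least three quarters of the cube.\<close>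
  define G where "G = {\<omega>\<in>?\<Omega>. W \<omega> \<le> 192 * \<sigma>^2}"
  have W0: "W \<omega> \<ge> 0" for \<omega> unfolding W_def using s by (intro sum_nonneg) (auto simp: less_imp_le)
  have "192 * \<sigma>^2 * real (card (?\<Omega> - G)) = (\<Sum>\<omega>\<in>?\<Omega> - G. 192 * \<sigma>^2)" by simp
  also have "\<dots> \<le> (\<Sum>\<omega>\<in>?\<Omega> - G. W \<omega>)" by (intro sum_mono) (auto simp: G_def)
  also have "\<dots> \<le> (\<Sum>\<omega>\<in>?\<Omega>. W \<omega>)" using fin\<Omega> W0 by (intro sum_mono2) auto
  also note mean
  finally have "192 * \<sigma>^2 * real (card (?\<Omega> - G)) \<le> 192 * \<sigma>^2 * (?N / 4)" by simp
  then have "real (card (?\<Omega> - G)) \<le> ?N / 4" using \<sigma> by simp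
  moreover have "real (card (?\<Omega> - G)) = ?N - real (card G)"
  proof -
    have "G \<subseteq> ?\<Omega>" unfolding G_def by auto
    then have "card (?\<Omega> - G) = card ?\<Omega> - card G" "card G \<le> card ?\<Omega>"
      using fin\<Omega> by (auto simp: card_Diff_subset finite_subset card_mono)
    then show ?thesis using card_cube[OF finite_bit_positions[OF I, of L]] by simp
  qed
  ultimately have G: "real (card G) \<ge> 3 / 4 * ?N" by simp
  have sub: "G \<subseteq> {\<omega>\<in>?\<Omega>. \<exists>t. (\<forall>i\<in>I. \<bar>t i\<bar> \<le> (ln (real n) + 28) * \<sigma>) \<and>
           (\<forall>a<n. (\<Sum>i\<in>I. centred_count L \<omega> i * z i a) = (\<Sum>i\<in>I. t i * z i a))}"
  proof safe
    fix \<omega> assume "\<omega> \<in> G"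
    then show "\<omega> \<in> ?\<Omega>" unfolding G_def by auto
    have W: "W \<omega> \<le> 192 * \<sigma>^2" using \<open>\<omega> \<in> G\<close> unfolding G_def by auto
    define r where "r i = (\<Sum>j\<in>I. R i j * e \<omega> j)" for i
    have r: "\<bar>r i\<bar> \<le> 28 * \<sigma>" if i: "i \<in> I" for i
    proof -
      have "(r i)^2 \<le> (\<Sum>j\<in>I. s j * (R i j)^2) * W \<omega>"
        unfolding r_def W_def using s(1) by (rule weighted_Cauchy_Schwarz)
      also have "\<dots> \<le> 4 * (192 * \<sigma>^2)"
        using R(2)[OF i] W W0 by (intro mult_mono) auto
      \<comment> \<open>\<open>4 * 192 = 768 \<le> 784 = 28\<^sup>2\<close>.\<close>
      also have "\<dots> \<le> (28 * \<sigma>)^2" by (simp add: power_mult_distrib)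
      finally show ?thesis using \<sigma> abs_le_square_iff[of "r i" "28 * \<sigma>"] by simp
    qed
    show "\<exists>t. (\<forall>i\<in>I. \<bar>t i\<bar> \<le> (ln (real n) + 28) * \<sigma>) \<and>
           (\<forall>a<n. (\<Sum>i\<in>I. centred_count L \<omega> i * z i a) = (\<Sum>i\<in>I. t i * z i a))"
    proof (intro exI[of _ "\<lambda>i. clip (\<theta> * \<sigma>) (t \<omega> i) + r i"] conjI ballI allI impI)
      fix i assume i: "i \<in> I"
      have "\<bar>clip (\<theta> * \<sigma>) (t \<omega> i)\<bar> \<le> \<theta> * \<sigma>" using \<theta> \<sigma> by (intro abs_clip_le) auto
      then show "\<bar>clip (\<theta> * \<sigma>) (t \<omega> i) + r i\<bar> \<le> (ln (real n) + 28) * \<sigma>"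
        using r[OF i] unfolding \<theta>_def[symmetric] by (simp add: distrib_right)
    next
      fix a assume a: "a < n"
      have "(\<Sum>i\<in>I. (clip (\<theta> * \<sigma>) (t \<omega> i) + r i) * z i a)
          = (\<Sum>i\<in>I. clip (\<theta> * \<sigma>) (t \<omega> i) * z i a) + (\<Sum>i\<in>I. r i * z i a)"
        by (simp add: distrib_right sum.distrib)
      also have "(\<Sum>i\<in>I. r i * z i a) = (\<Sum>i\<in>I. e \<omega> i * z i a)"
        unfolding r_def by (rule repr[OF a])
      also have "(\<Sum>i\<in>I. clip (\<theta> * \<sigma>) (t \<omega> i) * z i a) + \<dots> = (\<Sum>i\<in>I. t \<omega> i * z i a)"
        unfolding e_def by (simp add: left_diff_distrib sum_subtractf)
      also have "\<dots> = (\<Sum>i\<in>I. centred_count L \<omega> i * z i a)"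
        unfolding t_def by (rule repr[OF a])
      finally show "(\<Sum>i\<in>I. centred_count L \<omega> i * z i a) = (\<Sum>i\<in>I. (clip (\<theta> * \<sigma>) (t \<omega> i) + r i) * z i a)" ..
    qed
  qed
  have "real (card G) \<le> real (card {\<omega>\<in>?\<Omega>. \<exists>t. (\<forall>i\<in>I. \<bar>t i\<bar> \<le> (ln (real n) + 28) * \<sigma>) \<and>
           (\<forall>a<n. (\<Sum>i\<in>I. centred_count L \<omega> i * z i a) = (\<Sum>i\<in>I. t i * z i a))})"
    using sub fin\<Omega> by (intro of_nat_mono card_mono) auto
  with G show ?thesis by linarith
qed

section \<open>Covering all lattice points modulo a prime\<close>

text \<open>
  The trivial character contributes \<open>1\<close>.  For any other \<open>v\<close> let \<open>A\<close> be the sum of the distances of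
  the \<open>\<langle>v, z\<^sub>i\<rangle>\<close> to the multiples of \<open>p\<close>.  Cauchy-Schwarz with \<open>\<Sum>\<^sub>i 1 / s\<^sub>i \<le> 4 n\<close> bounds the product by
  \<open>exp (- 9/2 n (A / D)\<^sup>2)\<close>.  As \<open>A \<ge> D\<close>, one can split off \<open>exp (- 2 n)\<close>, which absorbs the number
  \<open>2\<^sup>n\<close> in \<open>theta_sum_le\<close>.
\<close>
lemma weighted_theta_le:
  fixes z :: "'i \<Rightarrow> nat \<Rightarrow> int" and D \<sigma> :: real and p :: int
  assumes I: "finite I" "n \<le> card I" and n: "n \<ge> 2" and D: "D = real (card I) - real n + 1"
    and frame: "\<And>T. T \<subseteq> I \<Longrightarrow> card T = n \<Longrightarrow> \<exists>d. integral_frame n T z d \<and> \<not> p dvd d"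
    and p: "prime p"
    and s: "\<And>i. i \<in> I \<Longrightarrow> s i > 0" "(\<Sum>i\<in>I. 1 / s i) \<le> 4 * real n"
    and \<sigma>: "\<sigma> = 3 * of_int p * real n / D" and L: "\<And>i. i \<in> I \<Longrightarrow> \<sigma>^2 * s i \<le> real (L i)"
  shows "(\<Sum>v\<in>residue_vectors n p. \<Prod>i\<in>I. \<bar>cos (pi * of_int (\<Sum>a<n. v a * z i a) / of_int p)\<bar> ^ L i) \<le> 5 / 4"
proof -
  let ?V = "residue_vectors n p"
  let ?P = "\<lambda>v. \<Prod>i\<in>I. \<bar>cos (pi * of_int (\<Sum>a<n. v a * z i a) / of_int p)\<bar> ^ L i"
  define f where "f v i = real_of_int (dist_to_multiples p (\<Sum>b<n. v b * z i b))" for v i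
  define A where "A v = sum (f v) I" for v
  have p0: "p > 0" using p by (simp add: prime_gt_0_int)
  have D0: "D > 0" using D I by simp
  have f0: "f v i \<ge> 0" for v i unfolding f_def using dist_to_multiples_nonneg[OF p0] by simp
  have A0: "A v \<ge> 0" for v unfolding A_def using f0 by (intro sum_nonneg)
  have bound: "?P v \<le> exp (- 2 * real n) * exp (- 2 * real n / D * A v)"
    if v: "a < n" "\<not> p dvd v a" for v a
  proof -
    have AD: "A v \<ge> D"
      unfolding A_def f_def D by (rule sum_dist_to_multiples_ge[of I n z p a v]) (use I frame p v in auto)
    have "(\<Sum>i\<in>I. f v i * 1)^2 \<le> (\<Sum>i\<in>I. s i * (f v i)^2) * (\<Sum>i\<in>I. 1^2 / s i)"
      using s(1) by (rule weighted_Cauchy_Schwarz)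
    also have "\<dots> \<le> (\<Sum>i\<in>I. s i * (f v i)^2) * (4 * real n)"
      using s by (intro mult_left_mono sum_nonneg mult_nonneg_nonneg) (auto simp: less_imp_le)
    finally have cs: "(A v)^2 \<le> (\<Sum>i\<in>I. s i * (f v i)^2) * (4 * real n)" by (simp add: A_def)
    have "2 + 2 * (A v / D) \<le> 9 / 2 * (A v / D)^2"
    proof -
      have x: "A v / D \<ge> 1" using AD D0 by simp
      then have "1 * (A v / D) \<le> (A v / D) * (A v / D)" by (intro mult_right_mono) auto
      then show ?thesis using x unfolding power2_eq_square by linarith
    qed
    then have "real n * (2 + 2 * (A v / D)) \<le> real n * (9 / 2 * (A v / D)^2)"
      by (intro mult_left_mono) auto
    also have "\<dots> = 9 * (real n)^2 / D^2 * ((A v)^2 / (2 * real n))"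
      using n by (simp add: power_divide power2_eq_square)
    also have "\<dots> \<le> 9 * (real n)^2 / D^2 * (2 * (\<Sum>i\<in>I. s i * (f v i)^2))"
      using cs n by (intro mult_left_mono) (auto simp: field_simps)
    also have "\<dots> = 2 * (\<Sum>i\<in>I. (\<sigma>^2 * s i) * (f v i / of_int p)^2)"
      unfolding sum_distrib_left \<sigma> using p0 D0
      by (intro sum.cong refl) (simp add: power_divide power_mult_distrib)
    also have "\<dots> \<le> 2 * (\<Sum>i\<in>I. real (L i) * (f v i / of_int p)^2)"
      using L by (intro mult_left_mono sum_mono mult_right_mono) auto
    finally have main: "real n * (2 + 2 * (A v / D)) \<le> 2 * (\<Sum>i\<in>I. real (L i) * (f v i / of_int p)^2)" .
    have "?P v \<le> (\<Prod>i\<in>I. exp (- 2 * (f v i / of_int p)^2) ^ L i)"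
      unfolding f_def by (intro prod_mono conjI power_mono abs_cos_le_exp p0) auto
    also have "\<dots> = exp (\<Sum>i\<in>I. real (L i) * (- 2 * (f v i / of_int p)^2))"
      by (simp only: exp_sum[OF I(1)] exp_of_nat_mult)
    also have "(\<Sum>i\<in>I. real (L i) * (- 2 * (f v i / of_int p)^2)) = - 2 * (\<Sum>i\<in>I. real (L i) * (f v i / of_int p)^2)"
      unfolding sum_distrib_left by (intro sum.cong refl) simp
    also have "exp \<dots> \<le> exp (- (real n * (2 + 2 * (A v / D))))" using main by simp
    also have "- (real n * (2 + 2 * (A v / D))) = - 2 * real n + - 2 * real n / D * A v"
      by (simp add: algebra_simps)
    finally show ?thesis by (simp only: exp_add)
  qed
  define v0 where "v0 = (\<lambda>a\<in>{..<n}. 0::int)"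
  have v0: "v0 \<in> ?V" unfolding v0_def residue_vectors_def using p0 by auto
  have P0: "?P v0 = 1" by (simp add: v0_def)
  have rest: "?P v \<le> exp (- 2 * real n) * exp (- 2 * real n / D * A v)" if v: "v \<in> ?V - {v0}" for v
  proof -
    have "\<exists>a<n. \<not> p dvd v a"
    proof (rule ccontr)
      assume "\<not> (\<exists>a<n. \<not> p dvd v a)"
      then have "p dvd v a - v0 a" if "a < n" for a using that by (simp add: v0_def)
      then show False using residue_vectors_eqI[of v n p v0] v v0 by blast
    qed
    then show ?thesis using bound by blast
  qed
  have "(\<Sum>v\<in>?V. ?P v) = ?P v0 + (\<Sum>v\<in>?V - {v0}. ?P v)"
    by (rule sum.remove[OF finite_residue_vectors v0])
  also have "\<dots> \<le> 1 + (\<Sum>v\<in>?V - {v0}. exp (- 2 * real n) * exp (- 2 * real n / D * A v))"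
    unfolding P0 by (intro add_left_mono sum_mono rest)
  also have "\<dots> \<le> 1 + (\<Sum>v\<in>?V. exp (- 2 * real n) * exp (- 2 * real n / D * A v))"
    by (intro add_left_mono sum_mono2 finite_residue_vectors) auto
  also have "\<dots> = 1 + exp (- 2 * real n) * (\<Sum>v\<in>?V. exp (- 2 * real n / D * A v))"
    by (simp only: sum_distrib_left)
  also have "\<dots> \<le> 1 + exp (- 2 * real n) * 2 ^ n"
    unfolding A_def f_def
    by (intro add_left_mono mult_left_mono theta_sum_le[OF I _ D _ p]) (use n frame in auto)
  also have "exp (- 2 * real n) * 2 ^ n = (exp (- 2) * 2) ^ n"
    by (simp add: power_mult_distrib exp_of_nat_mult[symmetric] mult.commute)
  also have "(exp (- 2) * 2) ^ n \<le> (1 / 2 :: real) ^ n"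
  proof (rule power_mono)
    have "exp (1::real) \<ge> 2" using exp_ge_add_one_self[of 1] by simp
    then have "exp (1::real) * exp 1 \<ge> 2 * 2" by (intro mult_mono) auto
    then show "exp (- 2) * 2 \<le> (1 / 2 :: real)" by (simp add: exp_minus mult_exp_exp field_simps)
  qed simp
  also have "(1 / 2 :: real) ^ n \<le> (1 / 2) ^ 2" using n by (intro power_decreasing) auto
  finally show ?thesis by (simp add: power2_eq_square)
qed

text \<open>
  The sets \<open>A\<close> and \<open>y - A\<close> each contain more than half of the group, so they meet.
\<close>
lemma half_residues_sum_cover:
  fixes A :: "(nat \<Rightarrow> int) set"
  assumes p: "p > 0" and A: "A \<subseteq> residue_vectors n p" "2 * card A > nat p ^ n"
  shows "\<exists>u\<in>A. \<exists>u'\<in>A. \<forall>a<n. p dvd y a - u a - u' a"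
proof -
  let ?V = "residue_vectors n p"
  define g where "g u = (\<lambda>a\<in>{..<n}. (y a - u a) mod p)" for u
  have gV: "g u \<in> ?V" for u unfolding g_def residue_vectors_def using p by auto
  have g_dvd: "p dvd y a - u a - g u a" if "a < n" for u a
    using that unfolding g_def by (simp add: minus_mod_eq_mult_div)
  have inj: "inj_on g A"
  proof (rule inj_onI)
    fix u u' assume u: "u \<in> A" "u' \<in> A" "g u = g u'"
    have "p dvd u a - u' a" if "a < n" for a
    proof -
      have "u a - u' a = (y a - u' a - g u' a) - (y a - u a - g u a)" using u(3) by simp
      then show ?thesis using g_dvd[OF that] by (simp only: dvd_diff)
    qed
    then show "u = u'" using residue_vectors_eqI[of u n p u'] u A by blast
  qed
  have "A \<inter> g ` A \<noteq> {}"
  proof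
    assume "A \<inter> g ` A = {}"
    have finA: "finite A" using A(1) finite_residue_vectors finite_subset by blast
    have "card (A \<union> g ` A) = card A + card (g ` A)"
      using \<open>A \<inter> g ` A = {}\<close> finA by (intro card_Un_disjoint) auto
    also have "\<dots> = 2 * card A" using inj by (simp add: card_image)
    finally have "card (A \<union> g ` A) > card ?V" using A(2) card_residue_vectors[OF p] by simp
    moreover have "card (A \<union> g ` A) \<le> card ?V"
      using A(1) gV by (intro card_mono finite_residue_vectors) auto
    ultimately show False by simp
  qed
  then obtain u where "u \<in> A" "g u \<in> A" by auto
  then show ?thesis using g_dvd by blast
qed

text \<open>
  The good part of the cube has relative size at least \<open>3/4\<close>, and each residue class receives at
  most \<open>5/4\<close> of its fair share.  So the good points occupy at least \<open>3/5\<close> of all residue classes,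
  and every class is a sum of two of these.
\<close>
lemma integer_points_covered:
  fixes z :: "'i \<Rightarrow> nat \<Rightarrow> int" and D \<sigma> :: real and p :: int
  assumes I: "finite I" "n \<le> card I" and n: "n \<ge> 2" and D: "D = real (card I) - real n + 1"
    and frame: "\<And>T. T \<subseteq> I \<Longrightarrow> card T = n \<Longrightarrow> \<exists>d. integral_frame n T z d \<and> \<not> p dvd d"
    and p: "prime p"
    and s: "\<And>i. i \<in> I \<Longrightarrow> s i > 0" "(\<Sum>i\<in>I. 1 / s i) \<le> 4 * real n"
    and R: "\<And>j a. j \<in> I \<Longrightarrow> a < n \<Longrightarrow> (\<Sum>i\<in>I. R i j * of_int (z i a)) = of_int (z j a)"
      "\<And>i. i \<in> I \<Longrightarrow> (\<Sum>j\<in>I. s j * (R i j)^2) \<le> 4"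
    and \<sigma>: "\<sigma> = 3 * of_int p * real n / D" and large: "\<And>i. i \<in> I \<Longrightarrow> \<sigma>^2 * s i \<ge> 1"
  shows "\<exists>t (w :: nat \<Rightarrow> int). (\<forall>i\<in>I. \<bar>t i\<bar> \<le> 2 * ((ln (real n) + 28) * \<sigma>)) \<and>
           (\<forall>a<n. real_of_int (y a) = (\<Sum>i\<in>I. t i * of_int (z i a)) + of_int (p * w a))"
proof -
  define L where "L i = nat \<lceil>\<sigma>^2 * s i\<rceil>" for i
  have L: "\<sigma>^2 * s i \<le> real (L i)" "real (L i) \<le> 2 * \<sigma>^2 * s i" if "i \<in> I" for i
  proof -
    have "real (L i) = of_int \<lceil>\<sigma>^2 * s i\<rceil>" unfolding L_def using large[OF that] by simp
    then show "\<sigma>^2 * s i \<le> real (L i)" "real (L i) \<le> 2 * \<sigma>^2 * s i"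
      using large[OF that] by linarith+
  qed
  have p0: "p > 0" using p by (simp add: prime_gt_0_int)
  have \<sigma>0: "\<sigma> > 0" unfolding \<sigma> D using p0 n I by simp
  let ?S = "bit_positions I L"
  let ?\<Omega> = "cube ?S"
  let ?N = "(2::real) ^ card ?S"
  let ?V = "residue_vectors n p"
  have finS: "finite ?S" using finite_bit_positions[OF I(1)] .
  have fin\<Omega>: "finite ?\<Omega>" using finite_cube[OF finS] .
  define X where "X \<omega> a = (\<Sum>x\<in>?S. \<omega> x * z (fst x) a)" for \<omega> a
  have X_count: "real_of_int (X \<omega> a) = (\<Sum>i\<in>I. (centred_count L \<omega> i + real (L i) / 2) * of_int (z i a))" for \<omega> a
    unfolding X_def sum_bit_positions[OF I(1)] centred_count_def by (simp add: sum_subtractf sum_distrib_right)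
  define G where "G = {\<omega>\<in>?\<Omega>. \<exists>t. (\<forall>i\<in>I. \<bar>t i\<bar> \<le> (ln (real n) + 28) * \<sigma>) \<and>
           (\<forall>a<n. (\<Sum>i\<in>I. centred_count L \<omega> i * of_int (z i a)) = (\<Sum>i\<in>I. t i * of_int (z i a)))}"
  have G: "real (card G) \<ge> 3 / 4 * ?N"
    unfolding G_def
    by (rule centred_count_has_small_coefficients[OF I(1) _ s R \<sigma>0 L(2)]) (use n in auto)
  have fibre: "real (card {\<omega>\<in>?\<Omega>. \<forall>a<n. p dvd X \<omega> a - u a}) * of_int p ^ n \<le> ?N * (5 / 4)" for u
  proof -
    have "real (card {\<omega>\<in>?\<Omega>. \<forall>a<n. p dvd X \<omega> a - u a}) * of_int p ^ n
        \<le> ?N * (\<Sum>v\<in>?V. \<Prod>x\<in>?S. \<bar>cos (pi * of_int (\<Sum>a<n. v a * z (fst x) a) / of_int p)\<bar>)"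
      unfolding X_def by (rule cube_fibre_bound[OF finS p0])
    also have "(\<Sum>v\<in>?V. \<Prod>x\<in>?S. \<bar>cos (pi * of_int (\<Sum>a<n. v a * z (fst x) a) / of_int p)\<bar>)
       = (\<Sum>v\<in>?V. \<Prod>i\<in>I. \<bar>cos (pi * of_int (\<Sum>a<n. v a * z i a) / of_int p)\<bar> ^ L i)"
    proof (intro sum.cong refl)
      fix v
      let ?q = "\<lambda>i. \<bar>cos (pi * of_int (\<Sum>a<n. v a * z i a) / of_int p)\<bar>"
      have "(\<Prod>i\<in>I. \<Prod>l<L i. ?q i) = (\<Prod>x\<in>?S. case x of (i, l) \<Rightarrow> ?q i)"
        unfolding bit_positions_def using I(1) by (intro prod.Sigma) auto
      then show "(\<Prod>x\<in>?S. ?q (fst x)) = (\<Prod>i\<in>I. ?q i ^ L i)" by (simp add: case_prod_beta)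
    qed
    also have "?N * \<dots> \<le> ?N * (5 / 4)"
      by (intro mult_left_mono weighted_theta_le[OF I n D _ p s \<sigma> L(1)]) (use frame in auto)
    finally show ?thesis .
  qed
  define h where "h \<omega> = (\<lambda>a\<in>{..<n}. X \<omega> a mod p)" for \<omega>
  have "h \<omega> \<in> ?V" for \<omega> unfolding h_def residue_vectors_def using p0 by auto
  then have hV: "h ` G \<subseteq> ?V" by auto
  have h_dvd: "p dvd X \<omega> a - h \<omega> a" if "a < n" for \<omega> a
    using that unfolding h_def by (simp add: minus_mod_eq_mult_div)
  have finG: "finite G" unfolding G_def using fin\<Omega> by simp
  have "card G \<le> card (\<Union>u\<in>h ` G. {\<omega>\<in>?\<Omega>. \<forall>a<n. p dvd X \<omega> a - u a})"
    using h_dvd finG fin\<Omega> by (intro card_mono finite_UN_I) (auto simp: G_def)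
  also have "\<dots> \<le> (\<Sum>u\<in>h ` G. card {\<omega>\<in>?\<Omega>. \<forall>a<n. p dvd X \<omega> a - u a})"
    using finG by (intro card_UN_le) auto
  finally have "real (card G) \<le> real (\<Sum>u\<in>h ` G. card {\<omega>\<in>?\<Omega>. \<forall>a<n. p dvd X \<omega> a - u a})"
    by (rule of_nat_mono)
  also have "\<dots> = (\<Sum>u\<in>h ` G. real (card {\<omega>\<in>?\<Omega>. \<forall>a<n. p dvd X \<omega> a - u a}))" by (rule of_nat_sum)
  finally have "real (card G) \<le> \<dots>" .
  then have "real (card G) * of_int p ^ n \<le> (\<Sum>u\<in>h ` G. real (card {\<omega>\<in>?\<Omega>. \<forall>a<n. p dvd X \<omega> a - u a})) * of_int p ^ n"
    using p0 by (intro mult_right_mono) auto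
  also have "\<dots> \<le> (\<Sum>u\<in>h ` G. ?N * (5 / 4))"
    unfolding sum_distrib_right by (intro sum_mono fibre)
  also have "\<dots> = real (card (h ` G)) * (?N * (5 / 4))" by simp
  finally have le: "real (card G) * of_int p ^ n \<le> real (card (h ` G)) * (?N * (5 / 4))" .
  have "3 / 4 * ?N * of_int p ^ n \<le> real (card G) * of_int p ^ n"
    using G p0 by (intro mult_right_mono) auto
  also note le
  finally have "?N * (3 / 4 * of_int p ^ n) \<le> ?N * (real (card (h ` G)) * (5 / 4))" by (simp only: mult_ac)
  then have "3 / 4 * real_of_int p ^ n \<le> real (card (h ` G)) * (5 / 4)" by (rule mult_left_le_imp_le) simp
  moreover have "real_of_int p ^ n > 0" using p0 by simp
  ultimately have "real_of_int p ^ n < real (2 * card (h ` G))" by simp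
  moreover have "real_of_int p ^ n = real (nat p ^ n)" using p0 by simp
  ultimately have "2 * card (h ` G) > nat p ^ n" by (simp only: of_nat_less_iff)
  \<comment> \<open>The shift by \<open>L\<^sub>i z\<^sub>i\<close> undoes the centring of the bits: two means of \<open>L\<^sub>i / 2\<close> each.\<close>
  from half_residues_sum_cover[OF p0 hV this, of "\<lambda>a. y a + (\<Sum>i\<in>I. int (L i) * z i a)"]
  obtain \<omega> \<omega>' where \<omega>: "\<omega> \<in> G" "\<omega>' \<in> G"
    and dvd: "\<And>a. a < n \<Longrightarrow> p dvd y a + (\<Sum>i\<in>I. int (L i) * z i a) - h \<omega> a - h \<omega>' a" by blast
  obtain t where t: "\<And>i. i \<in> I \<Longrightarrow> \<bar>t i\<bar> \<le> (ln (real n) + 28) * \<sigma>"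
    "\<And>a. a < n \<Longrightarrow> (\<Sum>i\<in>I. centred_count L \<omega> i * of_int (z i a)) = (\<Sum>i\<in>I. t i * of_int (z i a))"
    using \<omega>(1) unfolding G_def by blast
  obtain t' where t': "\<And>i. i \<in> I \<Longrightarrow> \<bar>t' i\<bar> \<le> (ln (real n) + 28) * \<sigma>"
    "\<And>a. a < n \<Longrightarrow> (\<Sum>i\<in>I. centred_count L \<omega>' i * of_int (z i a)) = (\<Sum>i\<in>I. t' i * of_int (z i a))"
    using \<omega>(2) unfolding G_def by blast
  define w where "w a = (y a + (\<Sum>i\<in>I. int (L i) * z i a) - X \<omega> a - X \<omega>' a) div p" for a
  have w: "p * w a = y a + (\<Sum>i\<in>I. int (L i) * z i a) - X \<omega> a - X \<omega>' a" if a: "a < n" for a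
  proof -
    have "y a + (\<Sum>i\<in>I. int (L i) * z i a) - X \<omega> a - X \<omega>' a
      = (y a + (\<Sum>i\<in>I. int (L i) * z i a) - h \<omega> a - h \<omega>' a) - (X \<omega> a - h \<omega> a) - (X \<omega>' a - h \<omega>' a)" by simp
    then have "p dvd y a + (\<Sum>i\<in>I. int (L i) * z i a) - X \<omega> a - X \<omega>' a"
      using dvd[OF a] h_dvd[OF a, of \<omega>] h_dvd[OF a, of \<omega>'] by (simp only: dvd_diff)
    then show ?thesis unfolding w_def by (rule dvd_mult_div_cancel)
  qed
  show ?thesis
  proof (intro exI[of _ "\<lambda>i. t i + t' i"] exI[of _ w] conjI ballI allI impI)
    fix i assume i: "i \<in> I"
    show "\<bar>t i + t' i\<bar> \<le> 2 * ((ln (real n) + 28) * \<sigma>)"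
      using t(1)[OF i] t'(1)[OF i] by linarith
  next
    fix a assume a: "a < n"
    have "real_of_int (X \<omega> a) + real_of_int (X \<omega>' a)
      = (\<Sum>i\<in>I. centred_count L \<omega> i * of_int (z i a)) + (\<Sum>i\<in>I. centred_count L \<omega>' i * of_int (z i a)) + (\<Sum>i\<in>I. real (L i) * of_int (z i a))"
      unfolding X_count sum.distrib[symmetric] by (intro sum.cong refl) (simp add: field_simps)
    also have "\<dots> = (\<Sum>i\<in>I. (t i + t' i) * of_int (z i a)) + of_int (\<Sum>i\<in>I. int (L i) * z i a)"
      unfolding t(2)[OF a] t'(2)[OF a] by (simp add: distrib_right sum.distrib)
    finally show "real_of_int (y a) = (\<Sum>i\<in>I. (t i + t' i) * of_int (z i a)) + of_int (p * w a)"
      unfolding w[OF a] by simp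
  qed
qed

section \<open>Covering all real points\<close>

lemma ln_ge_half: "n \<ge> 2 \<Longrightarrow> ln (real n) \<ge> 1 / 2"
proof -
  assume n: "n \<ge> 2"
  have "exp (1::real) \<le> 2 ^ 2" using exp_le by simp
  then have "1 \<le> ln ((2::real) ^ 2)" by (subst ln_ge_iff) auto
  then have "1 / 2 \<le> ln (2::real)" by (subst (asm) ln_realpow) auto
  also have "\<dots> \<le> ln (real n)" using n by simp
  finally show ?thesis .
qed

lemma integral_frame_unit_vectors:
  assumes "integral_frame n T z d" and d: "d \<noteq> 0" and T: "T \<subseteq> I" "finite I"
  obtains u :: "nat \<Rightarrow> 'i \<Rightarrow> real" where
    "\<And>b a. b < n \<Longrightarrow> a < n \<Longrightarrow> (\<Sum>i\<in>I. u b i * of_int (z i a)) = (if b = a then 1 else 0)"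
proof -
  obtain c where c: "\<And>a b. a < n \<Longrightarrow> b < n \<Longrightarrow> (\<Sum>i\<in>T. c a i * z i b) = (if a = b then d else 0)"
    using assms(1) unfolding integral_frame_def by blast
  show thesis
  proof (rule that[of "\<lambda>b i. if i \<in> T then of_int (c b i) / of_int d else 0"])
    fix b a assume ba: "b < n" "a < n"
    have "(\<Sum>i\<in>I. (if i \<in> T then of_int (c b i) / of_int d else 0) * real_of_int (z i a))
        = (\<Sum>i\<in>T. of_int (c b i) / of_int d * real_of_int (z i a))"
      using T by (intro sum.mono_neutral_cong_right) auto
    also have "\<dots> = of_int (\<Sum>i\<in>T. c b i * z i a) / of_int d"
      by (simp add: sum_divide_distrib)
    also have "\<dots> = (if b = a then 1 else 0)" using c[OF ba] d by simp
    finally show "(\<Sum>i\<in>I. (if i \<in> T then of_int (c b i) / of_int d else 0) * real_of_int (z i a))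
        = (if b = a then 1 else 0)" .
  qed
qed

lemma exists_large_prime:
  fixes B :: real
  obtains p :: int where "prime p" "of_int p \<ge> B"
proof -
  obtain q :: nat where q: "prime q" "q > nat \<lceil>B\<rceil>" using bigger_prime by blast
  then have "real q \<ge> B" by linarith
  then show thesis using that[of "int q"] q(1) by simp
qed

text \<open>
  The prime \<open>p\<close> is chosen so large that it divides none of the determinants, that the numbers of
  bits can be rounded to integers within a factor \<open>2\<close>, and that the error made by rounding \<open>x\<close> to
  \<open>\<int>\<^sup>n / p\<close> has coefficients at most \<open>n ln n / D\<close>.  The three sums in \<open>B\<close> below correspond to these demands.
\<close>
lemma real_points_covered:
  fixes z :: "'i \<Rightarrow> nat \<Rightarrow> int" and D :: real
  assumes I: "finite I" "n \<le> card I" and n: "n \<ge> 2" and D: "D = real (card I) - real n + 1"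
    and frame: "\<And>T. T \<subseteq> I \<Longrightarrow> card T = n \<Longrightarrow> \<exists>d. d \<noteq> 0 \<and> integral_frame n T z d"
    and nz: "\<And>i. i \<in> I \<Longrightarrow> \<exists>a<n. z i a \<noteq> 0"
  shows "\<exists>t (w :: nat \<Rightarrow> int). (\<forall>i\<in>I. \<bar>t i\<bar> \<le> 343 * real n * ln (real n) / D) \<and>
           (\<forall>a<n. x a = (\<Sum>i\<in>I. t i * of_int (z i a)) + of_int (w a))"
proof -
  let ?z = "\<lambda>i a. real_of_int (z i a)"
  have D0: "D > 0" using D I by simp
  have ln0: "ln (real n) \<ge> 1 / 2" using ln_ge_half[OF n] .
  obtain T0 where T0: "T0 \<subseteq> I" "card T0 = n" using obtain_subset_with_card_n[OF I(2)] by blast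
  then obtain d0 where d0: "d0 \<noteq> 0" "integral_frame n T0 z d0" using frame by blast
  obtain u where u: "\<And>b a. b < n \<Longrightarrow> a < n \<Longrightarrow> (\<Sum>i\<in>I. u b i * ?z i a) = (if b = a then 1 else 0)"
    using integral_frame_unit_vectors[OF d0(2,1) T0(1) I(1)] by blast
  have span: "v a = 0" if v: "\<And>i. i \<in> I \<Longrightarrow> dot n v (?z i) = 0" and a: "a < n" for v a
  proof -
    have "dot n v (\<lambda>b. \<Sum>i\<in>I. u a i * ?z i b) = (\<Sum>b<n. v b * (if a = b then 1 else 0))"
      unfolding dot_def using u a by (intro sum.cong refl) auto
    then have "v a = dot n v (\<lambda>b. \<Sum>i\<in>I. u a i * ?z i b)"
      using a by (simp add: if_distrib cong: if_cong)
    also have "\<dots> = (\<Sum>i\<in>I. u a i * dot n v (?z i))" by (rule dot_sum_right)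
    finally show ?thesis using v by simp
  qed
  obtain s :: "'i \<Rightarrow> real" and R where s: "\<And>i. i \<in> I \<Longrightarrow> s i > 0" "(\<Sum>i\<in>I. 1 / s i) \<le> 4 * real n"
    and R: "\<And>j a. j \<in> I \<Longrightarrow> a < n \<Longrightarrow> (\<Sum>i\<in>I. R i j * ?z i a) = ?z j a"
      "\<And>i. i \<in> I \<Longrightarrow> (\<Sum>j\<in>I. s j * (R i j)^2) \<le> 4"
  proof (rule balanced_right_inverse[of I n ?z])
    show "\<exists>a<n. ?z i a \<noteq> 0" if "i \<in> I" for i using nz[OF that] by simp
  qed (use I(1) span in blast)+
  obtain d where d: "\<And>T. T \<subseteq> I \<Longrightarrow> card T = n \<Longrightarrow> d T \<noteq> 0 \<and> integral_frame n T z (d T)"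
    using frame by metis
  define U where "U i = (\<Sum>b<n. \<bar>u b i\<bar>)" for i
  define F where "F = {T. T \<subseteq> I \<and> card T = n}"
  have finF: "finite F" unfolding F_def using I(1) by simp
  define B where "B = (1 + (\<Sum>T\<in>F. real_of_int \<bar>d T\<bar>)) + (\<Sum>i\<in>I. D^2 / (9 * (real n)^2 * s i))
     + (\<Sum>i\<in>I. U i * D / (real n * ln (real n)))"
  have U0: "U i \<ge> 0" for i unfolding U_def by (intro sum_nonneg) auto
  have nn1: "0 \<le> D^2 / (9 * (real n)^2 * s i)" if "i \<in> I" for i using s(1)[OF that] by simp
  have nn2: "0 \<le> U i * D / (real n * ln (real n))" for i using U0[of i] D0 ln0 by simp
  have S: "0 \<le> (\<Sum>T\<in>F. real_of_int \<bar>d T\<bar>)" "0 \<le> (\<Sum>i\<in>I. D^2 / (9 * (real n)^2 * s i))"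
    "0 \<le> (\<Sum>i\<in>I. U i * D / (real n * ln (real n)))"
    using nn1 nn2 by (intro sum_nonneg; simp)+
  obtain p :: int where p: "prime p" "of_int p \<ge> B" using exists_large_prime by blast
  have p0: "p > 0" using p(1) by (simp add: prime_gt_0_int)
  have p_d: "\<exists>d. integral_frame n T z d \<and> \<not> p dvd d" if T: "T \<subseteq> I" "card T = n" for T
  proof -
    have "real_of_int \<bar>d T\<bar> \<le> (\<Sum>T\<in>F. real_of_int \<bar>d T\<bar>)"
      using T finF by (intro member_le_sum) (auto simp: F_def)
    then have "\<bar>d T\<bar> < p" using p(2) S unfolding B_def by linarith
    then have "\<not> p dvd d T" using d[OF T] zdvd_imp_le[of p "\<bar>d T\<bar>"] by auto
    then show ?thesis using d[OF T] by blast
  qed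
  define \<sigma> where "\<sigma> = 3 * of_int p * real n / D"
  have large: "\<sigma>^2 * s i \<ge> 1" if i: "i \<in> I" for i
  proof -
    have "D^2 / (9 * (real n)^2 * s i) \<le> (\<Sum>i\<in>I. D^2 / (9 * (real n)^2 * s i))"
      using i I(1) nn1 by (intro member_le_sum) auto
    then have "D^2 / (9 * (real n)^2 * s i) \<le> of_int p" using p(2) S unfolding B_def by linarith
    also have "\<dots> \<le> (of_int p)^2" using p0 by (simp add: power2_eq_square)
    finally have "D^2 \<le> (of_int p)^2 * (9 * (real n)^2 * s i)"
      using s(1)[OF i] n by (simp add: divide_le_eq)
    then show ?thesis unfolding \<sigma>_def using D0 by (simp add: field_simps power2_eq_square)
  qed
  have slack: "U i / of_int p \<le> real n * ln (real n) / D" if i: "i \<in> I" for i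
  proof -
    have "U i * D / (real n * ln (real n)) \<le> (\<Sum>i\<in>I. U i * D / (real n * ln (real n)))"
      using i I(1) nn2 by (intro member_le_sum) auto
    then have "U i * D / (real n * ln (real n)) \<le> of_int p" using p(2) S unfolding B_def by linarith
    then show ?thesis using p0 D0 ln0 n by (simp add: field_simps)
  qed
  define y where "y a = \<lfloor>of_int p * x a\<rfloor>" for a
  define f where "f a = of_int p * x a - of_int (y a)" for a
  have f: "0 \<le> f a" "f a \<le> 1" for a unfolding f_def y_def by linarith+
  obtain t w where t: "\<And>i. i \<in> I \<Longrightarrow> \<bar>t i\<bar> \<le> 2 * ((ln (real n) + 28) * \<sigma>)"
    and yw: "\<And>a. a < n \<Longrightarrow> real_of_int (y a) = (\<Sum>i\<in>I. t i * ?z i a) + of_int (p * w a)"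
    using integer_points_covered[OF I n D p_d p(1) s R \<sigma>_def large, of y] by blast
  define g where "g i = (\<Sum>b<n. f b * u b i)" for i
  have g: "\<bar>g i\<bar> \<le> U i" for i
  proof -
    have "\<bar>g i\<bar> \<le> (\<Sum>b<n. \<bar>f b * u b i\<bar>)" unfolding g_def by (rule sum_abs)
    also have "\<dots> \<le> U i" unfolding U_def
      using f by (intro sum_mono) (auto simp: abs_mult intro!: mult_left_le_one_le)
    finally show ?thesis .
  qed
  have fg: "f a = (\<Sum>i\<in>I. g i * ?z i a)" if a: "a < n" for a
  proof -
    have "(\<Sum>i\<in>I. g i * ?z i a) = (\<Sum>b<n. f b * (\<Sum>i\<in>I. u b i * ?z i a))"
      unfolding g_def sum_distrib_left sum_distrib_right by (subst sum.swap) (simp add: mult_ac)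
    also have "\<dots> = (\<Sum>b<n. f b * (if b = a then 1 else 0))"
      using u a by (intro sum.cong refl) auto
    also have "\<dots> = f a" using a by (simp add: if_distrib cong: if_cong)
    finally show ?thesis ..
  qed
  show ?thesis
  proof (intro exI[of _ "\<lambda>i. (t i + g i) / of_int p"] exI[of _ w] conjI ballI allI impI)
    fix i assume i: "i \<in> I"
    have "\<bar>(t i + g i) / of_int p\<bar> \<le> \<bar>t i\<bar> / of_int p + \<bar>g i\<bar> / of_int p"
      using p0 by (simp add: abs_divide add_divide_distrib[symmetric] divide_right_mono)
    also have "\<dots> \<le> 2 * ((ln (real n) + 28) * \<sigma>) / of_int p + U i / of_int p"
      using t[OF i] g[of i] p0 by (intro add_mono divide_right_mono) auto
    \<comment> \<open>\<open>28 \<le> 56 ln n\<close> because \<open>ln n \<ge> 1/2\<close>; with \<open>\<sigma> / p = 3 n / D\<close> this gives \<open>2 * 57 * 3 + 1 = 343\<close>.\<close>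
    also have "\<dots> \<le> 2 * ((57 * ln (real n)) * \<sigma>) / of_int p + real n * ln (real n) / D"
      using ln0 p0 D0 slack[OF i]
      by (intro add_mono divide_right_mono mult_left_mono mult_right_mono) (auto simp: \<sigma>_def)
    also have "\<dots> = 343 * real n * ln (real n) / D"
      unfolding \<sigma>_def using p0 D0 by (simp add: field_simps)
    finally show "\<bar>(t i + g i) / of_int p\<bar> \<le> 343 * real n * ln (real n) / D" .
  next
    fix a assume a: "a < n"
    have "of_int p * x a = of_int (y a) + f a" unfolding f_def by simp
    also have "\<dots> = (\<Sum>i\<in>I. (t i + g i) * ?z i a) + of_int p * of_int (w a)"
      unfolding yw[OF a] fg[OF a] by (simp add: distrib_right sum.distrib)
    finally have "x a = ((\<Sum>i\<in>I. (t i + g i) * ?z i a) + of_int p * of_int (w a)) / of_int p"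
      using p0 by (simp add: field_simps)
    then show "x a = (\<Sum>i\<in>I. (t i + g i) / of_int p * ?z i a) + of_int (w a)"
      using p0 by (simp add: add_divide_distrib sum_divide_distrib distrib_right)
  qed
qed

text \<open>
  Translating by \<open>h \<Sum>\<^sub>i z\<^sub>i\<close> moves coefficients from \<open>{-h..h}\<close> to \<open>{0..2 * h}\<close>.
\<close>
lemma real_points_covered_nonneg:
  fixes z :: "'i \<Rightarrow> nat \<Rightarrow> int" and D :: real
  assumes I: "finite I" "n \<le> card I" and n: "n \<ge> 2" and D: "D = real (card I) - real n + 1"
    and frame: "\<And>T. T \<subseteq> I \<Longrightarrow> card T = n \<Longrightarrow> \<exists>d. d \<noteq> 0 \<and> integral_frame n T z d"
    and nz: "\<And>i. i \<in> I \<Longrightarrow> \<exists>a<n. z i a \<noteq> 0"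
  shows "\<exists>t (w :: nat \<Rightarrow> int). (\<forall>i\<in>I. 0 \<le> t i \<and> t i \<le> 686 * real n * ln (real n) / D) \<and>
           (\<forall>a<n. x a = (\<Sum>i\<in>I. t i * of_int (z i a)) + of_int (w a))"
proof -
  define h where "h = 343 * real n * ln (real n) / D"
  obtain t w where t: "\<And>i. i \<in> I \<Longrightarrow> \<bar>t i\<bar> \<le> h"
    and eq: "\<And>a. a < n \<Longrightarrow> x a - (\<Sum>i\<in>I. h * of_int (z i a)) = (\<Sum>i\<in>I. t i * of_int (z i a)) + of_int (w a)"
    using real_points_covered[OF assms, of "\<lambda>a. x a - (\<Sum>i\<in>I. h * of_int (z i a))"] unfolding h_def by blast
  have "686 * real n * ln (real n) / D = 2 * h" unfolding h_def by simp
  moreover have "0 \<le> t i + h \<and> t i + h \<le> 2 * h" if "i \<in> I" for i using t[OF that] by linarith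
  moreover have "x a = (\<Sum>i\<in>I. (t i + h) * of_int (z i a)) + of_int (w a)" if "a < n" for a
    using eq[OF that] by (simp add: distrib_right sum.distrib)
  ultimately show ?thesis by (intro exI[of _ "\<lambda>i. t i + h"] exI[of _ w]) simp
qed

section \<open>The upper bound for lattice zonotopes\<close>

lemma vec_lin_indpt_iff:
  assumes T: "finite T" "T \<subseteq> carrier_vec n"
  shows "vec_lin_indpt n T \<longleftrightarrow>
    (\<forall>c. (\<forall>a<n. (\<Sum>v\<in>T. c v * v $ a) = 0) \<longrightarrow> (\<forall>v\<in>T. c v = 0))"
proof -
  interpret vec_space "TYPE(real)" n .
  have zero: "lincomb c T = 0\<^sub>v n \<longleftrightarrow> (\<forall>a<n. (\<Sum>v\<in>T. c v * v $ a) = 0)" for c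
    using lincomb_index[OF _ T(2), of _ c] lincomb_dim[OF T, of c]
    by (auto simp: vec_eq_iff)
  show ?thesis
  proof
    assume li: "vec_lin_indpt n T"
    show "\<forall>c. (\<forall>a<n. (\<Sum>v\<in>T. c v * v $ a) = 0) \<longrightarrow> (\<forall>v\<in>T. c v = 0)"
    proof (intro allI impI ballI, rule ccontr)
      fix c v assume "\<forall>a<n. (\<Sum>v\<in>T. c v * v $ a) = 0" "v \<in> T" "c v \<noteq> 0"
      then have "lin_dep T" using lin_dep_crit[OF T(1) subset_refl, where a = c and v = v] zero by auto
      with li show False by blast
    qed
  next
    assume "\<forall>c. (\<forall>a<n. (\<Sum>v\<in>T. c v * v $ a) = 0) \<longrightarrow> (\<forall>v\<in>T. c v = 0)"
    then show "vec_lin_indpt n T" using zero by (intro finite_lin_indpt2[OF T(1)]) (use T in auto)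
  qed
qed

lemma enumerate_finite:
  assumes "finite T" "card T = n"
  obtains e :: "nat \<Rightarrow> 'a" where "bij_betw e {..<n} T"
  using ex_bij_betw_nat_finite[OF assms(1)] assms(2) by (auto simp: lessThan_atLeast0)

lemma integer_lattice_floor:
  "v \<in> integer_lattice n \<Longrightarrow> a < n \<Longrightarrow> real_of_int \<lfloor>v $ a\<rfloor> = v $ a"
  unfolding integer_lattice_def by (auto elim: Ints_cases)

lemma integral_frame_of_lin_indpt:
  assumes T: "finite T" "card T = n" "T \<subseteq> integer_lattice n" and li: "vec_lin_indpt n T"
  shows "\<exists>d. d \<noteq> 0 \<and> integral_frame n T (\<lambda>v a. \<lfloor>v $ a\<rfloor>) d"
proof -
  obtain e where e: "bij_betw e {..<n} T" using enumerate_finite[OF T(1,2)] .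
  define ix where "ix = inv_into {..<n} e"
  have ix: "ix (e k) = k" if "k < n" for k
    unfolding ix_def using e that by (intro inv_into_f_f) (auto simp: bij_betw_def)
  have eT: "e k \<in> T" if "k < n" for k using e that by (auto simp: bij_betw_def)
  have reindex: "(\<Sum>v\<in>T. g v) = (\<Sum>k<n. g (e k))" for g :: "real vec \<Rightarrow> 'b::comm_monoid_add"
    by (rule sum.reindex_bij_betw[OF e, symmetric])
  define A where "A = mat n n (\<lambda>(b, k). \<lfloor>e k $ b\<rfloor>)"
  have A: "A \<in> carrier_mat n n" unfolding A_def by simp
  have int: "real_of_int \<lfloor>v $ a\<rfloor> = v $ a" if "v \<in> T" "a < n" for v a
    using integer_lattice_floor T(3) that by blast
  have carr: "T \<subseteq> carrier_vec n" using T(3) unfolding integer_lattice_def by auto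
  have "det A \<noteq> 0"
  proof
    assume "det A = 0"
    then obtain u where u: "u \<in> carrier_vec n" "u \<noteq> 0\<^sub>v n" "A *\<^sub>v u = 0\<^sub>v n"
      using det_0_iff_vec_prod_zero[OF A] by blast
    have "(\<Sum>v\<in>T. real_of_int (u $ ix v) * v $ a) = 0" if a: "a < n" for a
    proof -
      have "(A *\<^sub>v u) $ a = (\<Sum>k<n. \<lfloor>e k $ a\<rfloor> * u $ k)"
        using a u(1) unfolding A_def by (simp add: scalar_prod_def lessThan_atLeast0)
      then have "(\<Sum>k<n. \<lfloor>e k $ a\<rfloor> * u $ k) = 0" using u(3) a by simp
      then have "0 = real_of_int (\<Sum>k<n. \<lfloor>e k $ a\<rfloor> * u $ k)" by simp
      also have "\<dots> = (\<Sum>k<n. real_of_int (u $ ix (e k)) * e k $ a)"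
        unfolding of_int_sum using ix int[OF eT a] by (intro sum.cong refl) auto
      finally show ?thesis unfolding reindex by simp
    qed
    then have "\<forall>v\<in>T. real_of_int (u $ ix v) = 0"
      using li[unfolded vec_lin_indpt_iff[OF T(1) carr], THEN spec, of "\<lambda>v. real_of_int (u $ ix v)"] by simp
    then have "u $ k = 0" if "k < n" for k using eT[OF that] ix[OF that] by force
    then have "u = 0\<^sub>v n" using u(1) by (intro eq_vecI) auto
    with u(2) show False by simp
  qed
  moreover have "integral_frame n T (\<lambda>v a. \<lfloor>v $ a\<rfloor>) (det A)"
    unfolding integral_frame_def
  proof (intro exI[of _ "\<lambda>a v. adj_mat A $$ (ix v, a)"] allI impI)
    fix a b assume ab: "a < n" "b < n"
    note adj = adj_mat[OF A]
    have "(A * adj_mat A) $$ (b, a) = (\<Sum>k<n. \<lfloor>e k $ b\<rfloor> * adj_mat A $$ (k, a))"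
      using ab adj(1) unfolding A_def by (simp add: scalar_prod_def lessThan_atLeast0)
    also have "\<dots> = (\<Sum>v\<in>T. adj_mat A $$ (ix v, a) * \<lfloor>v $ b\<rfloor>)"
      unfolding reindex using ix by (intro sum.cong refl) auto
    finally show "(\<Sum>v\<in>T. adj_mat A $$ (ix v, a) * \<lfloor>v $ b\<rfloor>) = (if a = b then det A else 0)"
      unfolding adj(2) using ab by auto
  qed
  ultimately show ?thesis by blast
qed

lemma lattice_zonotope_iff:
  assumes S: "finite S" "S \<subseteq> carrier_vec n"
  shows "x \<in> lattice_zonotope n S \<longleftrightarrow> x \<in> carrier_vec n \<and>
    (\<exists>t. (\<forall>v\<in>S. 0 \<le> t v \<and> t v \<le> 1) \<and> (\<forall>a<n. x $ a = (\<Sum>v\<in>S. t v * v $ a)))"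
proof
  assume "x \<in> lattice_zonotope n S"
  then obtain f where f: "x = finsum_vec TYPE(real) n f S" "\<forall>v\<in>S. f v \<in> segment (0\<^sub>v n) v"
    unfolding lattice_zonotope_def minkowski_sum_def by blast
  have "\<forall>v\<in>S. \<exists>t. 0 \<le> t \<and> t \<le> 1 \<and> f v = (1 - t) \<cdot>\<^sub>v 0\<^sub>v n + t \<cdot>\<^sub>v v"
    using f(2) unfolding segment_def by blast
  then obtain t where t: "\<And>v. v \<in> S \<Longrightarrow> 0 \<le> t v \<and> t v \<le> 1 \<and> f v = (1 - t v) \<cdot>\<^sub>v 0\<^sub>v n + t v \<cdot>\<^sub>v v"
    by metis
  have fc: "f \<in> S \<rightarrow> carrier_vec n" using t S(2) by auto
  have "x \<in> carrier_vec n" unfolding f(1) using finsum_vec_closed[OF fc] .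
  moreover have "x $ a = (\<Sum>v\<in>S. t v * v $ a)" if a: "a < n" for a
  proof -
    have "x $ a = (\<Sum>v\<in>S. f v $ a)" unfolding f(1) by (rule index_finsum_vec[OF S(1) a fc])
    also have "\<dots> = (\<Sum>v\<in>S. t v * v $ a)"
      using S(2) a t by (intro sum.cong refl) auto
    finally show ?thesis .
  qed
  ultimately show "x \<in> carrier_vec n \<and>
    (\<exists>t. (\<forall>v\<in>S. 0 \<le> t v \<and> t v \<le> 1) \<and> (\<forall>a<n. x $ a = (\<Sum>v\<in>S. t v * v $ a)))"
    using t by blast
next
  assume "x \<in> carrier_vec n \<and>
    (\<exists>t. (\<forall>v\<in>S. 0 \<le> t v \<and> t v \<le> 1) \<and> (\<forall>a<n. x $ a = (\<Sum>v\<in>S. t v * v $ a)))"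
  then obtain t where x: "x \<in> carrier_vec n" and t: "\<And>v. v \<in> S \<Longrightarrow> 0 \<le> t v \<and> t v \<le> 1"
    and eq: "\<And>a. a < n \<Longrightarrow> x $ a = (\<Sum>v\<in>S. t v * v $ a)" by blast
  define f where "f v = (1 - t v) \<cdot>\<^sub>v 0\<^sub>v n + t v \<cdot>\<^sub>v v" for v
  have fc: "f \<in> S \<rightarrow> carrier_vec n" unfolding f_def using S(2) by auto
  have "x = finsum_vec TYPE(real) n f S"
  proof (rule eq_vecI)
    show "dim_vec x = dim_vec (finsum_vec TYPE(real) n f S)" using x finsum_vec_closed[OF fc] by auto
    fix a assume "a < dim_vec (finsum_vec TYPE(real) n f S)"
    then have a: "a < n" using finsum_vec_closed[OF fc] by auto
    have "finsum_vec TYPE(real) n f S $ a = (\<Sum>v\<in>S. f v $ a)" by (rule index_finsum_vec[OF S(1) a fc])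
    also have "\<dots> = (\<Sum>v\<in>S. t v * v $ a)"
      unfolding f_def using S(2) a by (intro sum.cong refl) auto
    finally show "x $ a = finsum_vec TYPE(real) n f S $ a" using eq[OF a] by simp
  qed
  moreover have "\<forall>v\<in>S. f v \<in> segment (0\<^sub>v n) v"
    unfolding f_def segment_def using t by blast
  ultimately show "x \<in> lattice_zonotope n S"
    unfolding lattice_zonotope_def minkowski_sum_def by blast
qed

definition translates_cover :: "nat \<Rightarrow> real vec set \<Rightarrow> real \<Rightarrow> bool" where
  "translates_cover n K \<rho> \<longleftrightarrow> {\<rho> \<cdot>\<^sub>v x + w | x w. x \<in> K \<and> w \<in> integer_lattice n} = carrier_vec n"

lemma zonotope_translates_cover:
  assumes n: "n \<ge> 2" and gen: "zonotope_generators n S" and lgp: "linear_general_position n S"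
  shows "n \<le> card S"
    and "translates_cover n (lattice_zonotope n S)
      (686 * real n * ln (real n) / (real (card S) - real n + 1))" (is "translates_cover n _ ?\<rho>")
    and "686 * real n * ln (real n) / (real (card S) - real n + 1) > 0"
proof -
  interpret vec_space "TYPE(real)" n .
  have S: "finite S" "S \<subseteq> integer_lattice n" "vec_span n S = carrier_vec n"
    using gen unfolding zonotope_generators_def by auto
  have carr: "S \<subseteq> carrier_vec n" using S(2) unfolding integer_lattice_def by auto
  have int: "real_of_int \<lfloor>v $ a\<rfloor> = v $ a" if "v \<in> S" "a < n" for v a
    using integer_lattice_floor S(2) that by blast
  have "dim \<le> card S" by (rule gen_ge_dim) (use S carr in auto)
  then show nS: "n \<le> card S" by (simp add: dim_is_n)
  have li: "vec_lin_indpt n T" if "T \<subseteq> S" "card T = n" for T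
    using lgp that unfolding linear_general_position_def by blast
  have frame: "\<exists>d. d \<noteq> 0 \<and> integral_frame n T (\<lambda>v a. \<lfloor>v $ a\<rfloor>) d" if T: "T \<subseteq> S" "card T = n" for T
    by (rule integral_frame_of_lin_indpt) (use T S li finite_subset in auto)
  \<comment> \<open>A zero generator would make every \<open>n\<close>-subset that contains it dependent.\<close>
  have nz: "\<exists>a<n. \<lfloor>v $ a\<rfloor> \<noteq> 0" if v: "v \<in> S" for v
  proof (rule ccontr)
    assume "\<not> (\<exists>a<n. \<lfloor>v $ a\<rfloor> \<noteq> 0)"
    then have v0: "v $ a = 0" if "a < n" for a using int[OF v that] that by simp
    have "n - 1 \<le> card (S - {v})" using nS v S(1) by simp
    then obtain T' where T': "T' \<subseteq> S - {v}" "card T' = n - 1" and finT': "finite T'"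
      by (rule obtain_subset_with_card_n)
    have T: "insert v T' \<subseteq> S" "card (insert v T') = n"
      using T' v n finT' by (auto simp: card_insert_if)
    have "(\<Sum>w\<in>insert v T'. (if w = v then 1 else 0) * w $ a) = 0" if "a < n" for a
      using v0[OF that] by (intro sum.neutral) auto
    then show False
      using li[OF T] T(1) carr finT' by (subst (asm) vec_lin_indpt_iff) (auto dest!: spec[of _ "\<lambda>w. if w = v then 1 else 0"])
  qed
  have D0: "real (card S) - real n + 1 > 0" using nS by simp
  show \<rho>0: "?\<rho> > 0" using D0 n by simp
  show "translates_cover n (lattice_zonotope n S) ?\<rho>"
    unfolding translates_cover_def
  proof (intro equalityI subsetI)
    fix y assume "y \<in> {?\<rho> \<cdot>\<^sub>v x + w | x w. x \<in> lattice_zonotope n S \<and> w \<in> integer_lattice n}"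
    then show "y \<in> carrier_vec n"
      using lattice_zonotope_iff[OF S(1) carr] unfolding integer_lattice_def by auto
  next
    fix y :: "real vec" assume y: "y \<in> carrier_vec n"
    obtain t w where t: "\<And>v. v \<in> S \<Longrightarrow> 0 \<le> t v \<and> t v \<le> ?\<rho>"
      and eq: "\<And>a. a < n \<Longrightarrow> y $ a = (\<Sum>v\<in>S. t v * of_int \<lfloor>v $ a\<rfloor>) + of_int (w a)"
      using real_points_covered_nonneg[OF S(1) nS n refl frame nz, of "($) y"] by blast
    define x where "x = vec n (\<lambda>a. \<Sum>v\<in>S. t v / ?\<rho> * v $ a)"
    define w' where "w' = vec n (\<lambda>a. real_of_int (w a))"
    have "x \<in> lattice_zonotope n S"
      unfolding lattice_zonotope_iff[OF S(1) carr]
    proof (intro conjI exI[of _ "\<lambda>v. t v / ?\<rho>"] ballI allI impI)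
      fix v assume v: "v \<in> S"
      show "0 \<le> t v / ?\<rho>" using t[OF v] \<rho>0 by (intro divide_nonneg_pos) auto
      show "t v / ?\<rho> \<le> 1" using t[OF v] \<rho>0 by (subst pos_divide_le_eq) auto
    qed (auto simp: x_def)
    moreover have "w' \<in> integer_lattice n" unfolding w'_def integer_lattice_def by auto
    moreover have "y = ?\<rho> \<cdot>\<^sub>v x + w'"
    proof (rule eq_vecI)
      fix a assume "a < dim_vec (?\<rho> \<cdot>\<^sub>v x + w')"
      then have a: "a < n" unfolding w'_def by simp
      have "?\<rho> * (\<Sum>v\<in>S. t v / ?\<rho> * v $ a) = (\<Sum>v\<in>S. t v * of_int \<lfloor>v $ a\<rfloor>)"
      proof -
        have cancel: "r * (b / r * c) = b * c" if "r > 0" for r b c :: real using that by simp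
        show ?thesis unfolding sum_distrib_left
          by (intro sum.cong refl) (simp only: cancel[OF \<rho>0] int[OF _ a])
      qed
      then show "y $ a = (?\<rho> \<cdot>\<^sub>v x + w') $ a" using a eq[OF a] unfolding x_def w'_def by simp
    qed (use y in \<open>auto simp: w'_def\<close>)
    ultimately show "y \<in> {?\<rho> \<cdot>\<^sub>v x + w | x w. x \<in> lattice_zonotope n S \<and> w \<in> integer_lattice n}"
      by blast
  qed
qed

lemma covering_radius_zonotope_le:
  assumes n: "n \<ge> 2" and gen: "zonotope_generators n S" and lgp: "linear_general_position n S"
  shows "covering_radius n (lattice_zonotope n S) \<le> 686 * real n * ln (real n) / (real (card S) - real n + 1)"
  unfolding covering_radius_def
  using zonotope_translates_cover[OF assms]
  by (intro cInf_lower bdd_belowI[of _ 0]) (auto simp: translates_cover_def)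

section \<open>Zonotopes of small width\<close>

text \<open>
  Pad the vectors by zero rows to a square matrix: its transpose annihilates the last unit vector,
  so the matrix is singular.
\<close>
lemma exists_orthogonal_vector:
  assumes T: "finite T" "card T < n"
  shows "\<exists>c :: nat \<Rightarrow> real. (\<exists>a<n. c a \<noteq> 0) \<and> (\<forall>v\<in>T. (\<Sum>a<n. c a * v $ a) = 0)"
proof -
  obtain e where e: "bij_betw e {..<card T} T" using enumerate_finite[OF T(1) refl] .
  define A where "A = mat n n (\<lambda>(k, a). if k < card T then e k $ a else (0::real))"
  have A: "A \<in> carrier_mat n n" unfolding A_def by simp
  have "A\<^sup>T *\<^sub>v unit_vec n (n - 1) = 0\<^sub>v n"
  proof (rule eq_vecI)
    fix a assume "a < dim_vec (0\<^sub>v n :: real vec)"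
    then show "(A\<^sup>T *\<^sub>v unit_vec n (n - 1)) $ a = 0\<^sub>v n $ a"
      using T(2) A unfolding A_def by simp
  qed (simp add: A_def)
  moreover have "unit_vec n (n - 1) \<noteq> (0\<^sub>v n :: real vec)" using T(2) by simp
  ultimately have "det A\<^sup>T = 0"
    using A by (subst det_0_iff_vec_prod_zero[of _ n]) (auto intro!: exI[of _ "unit_vec n (n - 1)"])
  then have "det A = 0" using det_transpose[OF A] by simp
  then obtain c where c: "c \<in> carrier_vec n" "c \<noteq> 0\<^sub>v n" "A *\<^sub>v c = 0\<^sub>v n"
    using det_0_iff_vec_prod_zero[OF A] by blast
  show ?thesis
  proof (intro exI[of _ "($) c"] conjI ballI)
    show "\<exists>a<n. c $ a \<noteq> 0"
    proof (rule ccontr)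
      assume "\<not> (\<exists>a<n. c $ a \<noteq> 0)"
      then have "c = 0\<^sub>v n" using c(1) by (intro eq_vecI) auto
      with c(2) show False by simp
    qed
    fix v assume "v \<in> T"
    then obtain k where k: "k < card T" "v = e k" using e by (auto simp: bij_betw_def)
    then have kn: "k < n" using T(2) by simp
    have "(A *\<^sub>v c) $ k = (\<Sum>a<n. c $ a * v $ a)"
      using k kn c(1) unfolding A_def by (simp add: scalar_prod_def lessThan_atLeast0 mult.commute)
    then show "(\<Sum>a<n. c $ a * v $ a) = 0" using c(3) kn by simp
  qed
qed

lemma moment_curve_avoids_hyperplanes:
  fixes c :: "'i \<Rightarrow> nat \<Rightarrow> real"
  assumes F: "finite F" and nz: "\<And>j. j \<in> F \<Longrightarrow> \<exists>a<n. c j a \<noteq> 0"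
  shows "\<exists>N::nat. \<forall>j\<in>F. (\<Sum>a<n. c j a * real N ^ a) \<noteq> 0"
proof -
  define P where "P j = (\<Sum>a<n. monom (c j a) a)" for j
  have coeff: "coeff (P j) a = c j a" if "a < n" for j a
    unfolding P_def coeff_sum using that by (simp add: if_distrib cong: if_cong)
  have "P j \<noteq> 0" if "j \<in> F" for j using nz[OF that] coeff[of _ j] by force
  then have "finite (\<Union>j\<in>F. {x. poly (P j) x = 0})" using F poly_roots_finite by blast
  then have "finite (real -` (\<Union>j\<in>F. {x. poly (P j) x = 0}))" by (rule finite_vimageI) (simp add: inj_on_def)
  then obtain N :: nat where "N \<notin> real -` (\<Union>j\<in>F. {x. poly (P j) x = 0})" using ex_new_if_finite infinite_UNIV_nat by blast
  then have "poly (P j) (real N) \<noteq> 0" if "j \<in> F" for j using that by auto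
  then show ?thesis by (intro exI[of _ N]) (simp add: P_def poly_sum poly_monom)
qed

text \<open>
  All subsets of at most \<open>n\<close> points are required to be independent, and not only those of exactly
  \<open>n\<close>, so that the condition is meaningful for fewer than \<open>n\<close> points and can be preserved by adding
  points one at a time.
\<close>
definition generic_points :: "nat \<Rightarrow> real vec set \<Rightarrow> bool" where
  "generic_points n S \<longleftrightarrow> finite S \<and> S \<subseteq> integer_lattice n \<and> (\<forall>T\<subseteq>S. card T \<le> n \<longrightarrow> vec_lin_indpt n T)"

text \<open>
  A new point that lies off a hyperplane through each set \<open>T\<close> of fewer than \<open>n\<close> old points extends
  each independent \<open>T\<close> to an independent set.  On the moment curve with first coordinate \<open>1\<close> each
  hyperplane excludes only finitely many parameters, the roots of a nonzero polynomial.
\<close>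
lemma generic_points_extend:
  assumes n: "n \<ge> 2" and S: "generic_points n S"
  shows "\<exists>x. x \<in> integer_lattice n \<and> x $ 0 = 1 \<and> x \<notin> S \<and> generic_points n (insert x S)"
proof -
  have S': "finite S" "S \<subseteq> integer_lattice n" and li: "\<And>T. T \<subseteq> S \<Longrightarrow> card T \<le> n \<Longrightarrow> vec_lin_indpt n T"
    using S unfolding generic_points_def by auto
  have carr: "S \<subseteq> carrier_vec n" using S'(2) unfolding integer_lattice_def by auto
  define F where "F = {T. T \<subseteq> S \<and> card T < n}"
  have finF: "finite F" unfolding F_def using S'(1) by simp
  have "\<forall>T\<in>F. \<exists>c :: nat \<Rightarrow> real. (\<exists>a<n. c a \<noteq> 0) \<and> (\<forall>v\<in>T. (\<Sum>a<n. c a * v $ a) = 0)"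
    using exists_orthogonal_vector S'(1) finite_subset unfolding F_def by blast
  then obtain c :: "real vec set \<Rightarrow> nat \<Rightarrow> real" where
    c: "\<And>T. T \<in> F \<Longrightarrow> (\<exists>a<n. c T a \<noteq> 0) \<and> (\<forall>v\<in>T. (\<Sum>a<n. c T a * v $ a) = 0)"
    by metis
  obtain N :: nat where N: "\<And>T. T \<in> F \<Longrightarrow> (\<Sum>a<n. c T a * real N ^ a) \<noteq> 0"
    using moment_curve_avoids_hyperplanes[OF finF, of n c] c by blast
  define x where "x = vec n (\<lambda>a. real N ^ a)"
  have cx: "(\<Sum>a<n. c T a * x $ a) \<noteq> 0" if "T \<in> F" for T using N[OF that] by (simp add: x_def)
  have x: "x \<in> integer_lattice n" unfolding x_def integer_lattice_def by (auto intro: Ints_power)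
  have x_carr: "x \<in> carrier_vec n" by (simp add: x_def)
  have notin: "x \<notin> S"
  proof
    assume "x \<in> S"
    then have "{x} \<in> F" unfolding F_def using n by simp
    then show False using c[of "{x}"] cx[of "{x}"] by simp
  qed
  have "vec_lin_indpt n T" if T: "T \<subseteq> insert x S" "card T \<le> n" for T
  proof (cases "x \<in> T")
    case False
    then show ?thesis using li T by blast
  next
    case True
    define T' where "T' = T - {x}"
    have finT: "finite T" using T(1) S'(1) finite_subset by blast
    have T': "T' \<subseteq> S" "T = insert x T'" "x \<notin> T'" "finite T'" unfolding T'_def using T True finT by auto
    have cardT': "card T' < n" using T(2) T'(2,3,4) by simp
    have T'F: "T' \<in> F" unfolding F_def using T'(1) cardT' by simp
    have Tc: "T \<subseteq> carrier_vec n" using T(1) carr x_carr by auto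
    show ?thesis
      unfolding vec_lin_indpt_iff[OF finT Tc]
    proof (intro allI impI)
      fix b assume b: "\<forall>a<n. (\<Sum>v\<in>T. b v * v $ a) = 0"
      have split: "b x * x $ a + (\<Sum>v\<in>T'. b v * v $ a) = 0" if "a < n" for a
        using b that T'(3,4) unfolding T'(2) by simp
      have "0 = (\<Sum>a<n. c T' a * (b x * x $ a + (\<Sum>v\<in>T'. b v * v $ a)))"
        using split by simp
      also have "\<dots> = b x * (\<Sum>a<n. c T' a * x $ a) + (\<Sum>a<n. \<Sum>v\<in>T'. b v * (c T' a * v $ a))"
        by (simp add: distrib_left sum.distrib sum_distrib_left mult_ac)
      also have "(\<Sum>a<n. \<Sum>v\<in>T'. b v * (c T' a * v $ a)) = (\<Sum>v\<in>T'. b v * (\<Sum>a<n. c T' a * v $ a))"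
        unfolding sum_distrib_left by (rule sum.swap)
      also have "\<dots> = 0" using c[OF T'F] by simp
      finally have bx: "b x = 0" using cx[OF T'F] by simp
      have "\<forall>a<n. (\<Sum>v\<in>T'. b v * v $ a) = 0" using split bx by simp
      moreover have "vec_lin_indpt n T'" using li[OF T'(1)] cardT' by simp
      moreover have "T' \<subseteq> carrier_vec n" using T'(1) carr by auto
      ultimately have "\<forall>v\<in>T'. b v = 0" using vec_lin_indpt_iff[OF T'(4)] by blast
      then show "\<forall>v\<in>T. b v = 0" using bx unfolding T'(2) by simp
    qed
  qed
  then have "generic_points n (insert x S)"
    unfolding generic_points_def using S' x by auto
  moreover have "x $ 0 = 1" using n by (simp add: x_def)
  ultimately show ?thesis using x notin by blast
qed

lemma generic_points_unit_vectors:
  "generic_points n (unit_vec n ` {1..<n})"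
  unfolding generic_points_def
proof (intro conjI allI impI)
  show "unit_vec n ` {1..<n} \<subseteq> integer_lattice n"
    unfolding integer_lattice_def by (auto simp: unit_vec_def)
  fix T :: "real vec set" assume T: "T \<subseteq> unit_vec n ` {1..<n}"
  then have fin: "finite T" using finite_subset by blast
  have carr: "T \<subseteq> carrier_vec n" using T by auto
  show "vec_lin_indpt n T"
    unfolding vec_lin_indpt_iff[OF fin carr]
  proof (intro allI impI ballI)
    fix b v assume b: "\<forall>a<n. (\<Sum>v\<in>T. b v * v $ a) = 0" and v: "v \<in> T"
    then obtain i where i: "i < n" "v = unit_vec n i" using T by auto
    have "(\<Sum>w\<in>T. b w * w $ i) = (\<Sum>w\<in>T. if w = v then b v else 0)"
    proof (intro sum.cong refl)
      fix w assume "w \<in> T"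
      then obtain j where "j < n" "w = unit_vec n j" using T by auto
      then have "w $ i = (if w = v then 1 else 0)" using i by (cases "j = i") auto
      then show "b w * w $ i = (if w = v then b v else 0)" by simp
    qed
    also have "\<dots> = b v" using fin v by simp
    finally show "b v = 0" using b i(1) by simp
  qed
qed simp

lemma generic_points_small_width:
  assumes n: "n \<ge> 2"
  shows "\<exists>S. generic_points n S \<and> card S = n - 1 + k \<and> (\<forall>v\<in>S. v $ 0 \<ge> 0) \<and> (\<Sum>v\<in>S. v $ 0) = real k"
proof (induction k)
  case 0
  have inj: "inj_on (unit_vec n :: nat \<Rightarrow> real vec) {1..<n}"
    by (rule inj_onI) (auto simp: unit_vec_def vec_eq_iff split: if_splits)
  have "v $ 0 = 0" if "v \<in> unit_vec n ` {1..<n}" for v :: "real vec"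
    using that n by (auto simp: unit_vec_def)
  then show ?case
    using generic_points_unit_vectors[of n] card_image[OF inj]
    by (intro exI[of _ "unit_vec n ` {1..<n}"]) auto
next
  case (Suc k)
  then obtain S where S: "generic_points n S" "card S = n - 1 + k" "\<forall>v\<in>S. v $ 0 \<ge> 0" "(\<Sum>v\<in>S. v $ 0) = real k"
    by blast
  obtain x where x: "x \<in> integer_lattice n" "x $ 0 = 1" "x \<notin> S" "generic_points n (insert x S)"
    using generic_points_extend[OF n S(1)] by blast
  have fin: "finite S" using S(1) unfolding generic_points_def by simp
  show ?case
    using S x fin by (intro exI[of _ "insert x S"]) auto
qed

text \<open>
  The first coordinates of \<open>\<rho> Z\<close> lie in \<open>{0..\<rho> * W}\<close>.  If \<open>\<rho> * W < 1\<close>, the midpoint of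
  \<open>{\<rho> * W..1}\<close> is the first coordinate of a point that no integral translate reaches.
\<close>
lemma covering_scale_ge_inverse_width:
  assumes S: "finite S" "S \<subseteq> carrier_vec n" and n: "n > 0"
    and nonneg: "\<forall>v\<in>S. v $ 0 \<ge> 0" and width: "(\<Sum>v\<in>S. v $ 0) = W" "W > 0"
    and \<rho>: "\<rho> > 0" "translates_cover n (lattice_zonotope n S) \<rho>"
  shows "\<rho> \<ge> 1 / W"
proof (rule ccontr)
  assume "\<not> \<rho> \<ge> 1 / W"
  then have lt: "\<rho> * W < 1" using width(2) by (simp add: field_simps)
  define y where "y = vec n (\<lambda>_. (\<rho> * W + 1) / 2)"
  have "y \<in> carrier_vec n" unfolding y_def by simp
  then obtain x w where x: "x \<in> lattice_zonotope n S" and w: "w \<in> integer_lattice n" and y: "y = \<rho> \<cdot>\<^sub>v x + w"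
    using \<rho>(2) unfolding translates_cover_def by blast
  obtain t where x_carr: "x \<in> carrier_vec n" and t: "\<And>v. v \<in> S \<Longrightarrow> 0 \<le> t v \<and> t v \<le> 1"
    and eq: "\<And>a. a < n \<Longrightarrow> x $ a = (\<Sum>v\<in>S. t v * v $ a)"
    using x lattice_zonotope_iff[OF S] by blast
  have "0 \<le> x $ 0" unfolding eq[OF n] using t nonneg by (intro sum_nonneg) auto
  have "x $ 0 \<le> (\<Sum>v\<in>S. v $ 0)"
    unfolding eq[OF n] using t nonneg by (intro sum_mono mult_left_le_one_le) auto
  then have "x $ 0 \<le> W" using width(1) by simp
  have w0: "w $ 0 \<in> \<int>" "w \<in> carrier_vec n" using w n unfolding integer_lattice_def by auto
  then obtain j where j: "w $ 0 = real_of_int j" by (auto elim: Ints_cases)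
  have "y $ 0 = \<rho> * x $ 0 + w $ 0" unfolding y using n w0(2) x_carr by simp
  then have "(\<rho> * W + 1) / 2 = \<rho> * x $ 0 + real_of_int j" using n j unfolding y_def by simp
  moreover have "0 \<le> \<rho> * x $ 0" "\<rho> * x $ 0 \<le> \<rho> * W"
    using \<open>0 \<le> x $ 0\<close> \<open>x $ 0 \<le> W\<close> \<rho>(1) by auto
  moreover have False if "(r + 1) / 2 = s + real_of_int j" "0 \<le> s" "s \<le> r" "r < 1" for r s :: real
  proof -
    have "2 * real_of_int j = r + 1 - 2 * s" using that(1) by (simp add: field_simps)
    then have "0 < 2 * real_of_int j" "2 * real_of_int j < 2" using that(2-4) by simp_all
    then show False by simp
  qed
  ultimately show False using lt by blast
qed

lemma exists_zonotope_with_large_covering_radius: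
  assumes n: "n \<ge> 2" and m: "m \<ge> n"
  shows "\<exists>S. zonotope_generators n S \<and> card S = m \<and> linear_general_position n S \<and>
           covering_radius n (lattice_zonotope n S) \<ge> 1 / (real m - real n + 1)"
proof -
  interpret vec_space "TYPE(real)" n .
  obtain S where S: "generic_points n S" "card S = n - 1 + (m - n + 1)" "\<forall>v\<in>S. v $ 0 \<ge> 0"
    and width: "(\<Sum>v\<in>S. v $ 0) = real (m - n + 1)"
    using generic_points_small_width[OF n, of "m - n + 1"] by blast
  have cardS: "card S = m" using S(2) n m by simp
  have S': "finite S" "S \<subseteq> integer_lattice n" and li: "\<And>T. T \<subseteq> S \<Longrightarrow> card T \<le> n \<Longrightarrow> vec_lin_indpt n T"
    using S(1) unfolding generic_points_def by auto
  have carr: "S \<subseteq> carrier_vec n" using S'(2) unfolding integer_lattice_def by auto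
  obtain T where T: "T \<subseteq> S" "card T = n" "finite T"
    using obtain_subset_with_card_n[of n S] cardS m by blast
  have "basis T"
    by (rule dim_li_is_basis) (use T carr li in \<open>auto simp: dim_is_n\<close>)
  then have "span T = carrier_vec n" unfolding basis_def by simp
  moreover have "span T \<subseteq> span S" using T(1) by (rule span_is_monotone)
  moreover have "span S \<subseteq> carrier_vec n" using span_is_subset2[of S] carr by simp
  ultimately have "vec_span n S = carrier_vec n" by blast
  then have gen: "zonotope_generators n S" unfolding zonotope_generators_def using S' by simp
  have lgp: "linear_general_position n S"
    unfolding linear_general_position_def using S'(1) carr li by simp
  have W: "real (m - n + 1) = real m - real n + 1" using m by simp
  have "1 / real (m - n + 1) \<le> covering_radius n (lattice_zonotope n S)"
    unfolding covering_radius_def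
  proof (rule cInf_greatest)
    show "{\<rho>. \<rho> > 0 \<and> {\<rho> \<cdot>\<^sub>v x + w | x w. x \<in> lattice_zonotope n S \<and> w \<in> integer_lattice n} = carrier_vec n} \<noteq> {}"
      using zonotope_translates_cover(2,3)[OF n gen lgp] unfolding translates_cover_def by blast
  next
    fix \<rho> assume "\<rho> \<in> {\<rho>. \<rho> > 0 \<and> {\<rho> \<cdot>\<^sub>v x + w | x w. x \<in> lattice_zonotope n S \<and> w \<in> integer_lattice n} = carrier_vec n}"
    then have "\<rho> > 0" "translates_cover n (lattice_zonotope n S) \<rho>" unfolding translates_cover_def by auto
    then show "1 / real (m - n + 1) \<le> \<rho>"
      using covering_scale_ge_inverse_width[OF S'(1) carr _ S(3) width] n by simp
  qed
  then show ?thesis using gen lgp cardS unfolding W by blast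
qed

theorem theorem1p5:
  shows "(\<exists>c::real. c > 0 \<and>
           (\<forall>(n::nat) (m::nat) S. n \<ge> 2 \<longrightarrow> zonotope_generators n S \<longrightarrow> card S = m \<longrightarrow>
              linear_general_position n S \<longrightarrow>
              covering_radius n (lattice_zonotope n S)
                \<le> c * real n * ln (real n) / (real m - real n + 1)))
       \<and> (\<forall>(n::nat) (m::nat). n \<ge> 2 \<longrightarrow> m \<ge> n \<longrightarrow>
           (\<exists>S. zonotope_generators n S \<and> card S = m \<and> linear_general_position n S \<and>
              covering_radius n (lattice_zonotope n S) \<ge> 1 / (real m - real n + 1)))"
proof (intro conjI exI[of _ "686 :: real"] allI impI)
  show "covering_radius n (lattice_zonotope n S) \<le> 686 * real n * ln (real n) / (real m - real n + 1)"
    if "n \<ge> 2" "zonotope_generators n S" "card S = m" "linear_general_position n S" for n m :: nat and S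
    using covering_radius_zonotope_le[of n S] that by simp
  show "\<exists>S. zonotope_generators n S \<and> card S = m \<and> linear_general_position n S \<and>
           covering_radius n (lattice_zonotope n S) \<ge> 1 / (real m - real n + 1)"
    if "n \<ge> 2" "m \<ge> n" for n m :: nat
    using exists_zonotope_with_large_covering_radius that by simp
qed simp

end
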